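(* Let $i\in I_0$ and let $b\in\mathcal{B}^{\otimes\ell}$ be $\{1,2,\dots,i\}$-highest weight with $\varepsilon_{-i}(b)=1$. Let $b_{p_{i+1}},\dots,b_{p_1}$ be the initial $(i+1)$-sequence of $b$. Then $e_{-i}(b)$ is obtained from $b$ by the following algorithm: (i) change $b_{p_j}$ from $j$ to $j-1$ for $j=i+1,i,\dots,3,2$; call the result $c^{(1)}$; (ii) for $m=1,2,\dots,i-1$ in turn: in $c^{(m)}$, cyclically scan leftwards, starting just to the left of position $t_{m-1}$ (where $t_0=p_1$), for a letter $m$ that is not $i$-bracketed in $c^{(m)}$; let $t_m$ be its position, and change this letter to $m+1$, obtaining $c^{(m+1)}$. The resulting word $c^{(i)}$ equals $e_{-i}(b)$.
   Context: Fix $n\ge1$, $\ell\ge1$, $I_0=\{1,\dots,n\}$. $\mathcal{B}^{\otimes\ell}$ is the set of words $b=b_1\cdots b_\ell$ with letters in $\{1,\dots,n+1\}$. Operators map to $\mathcal{B}^{\otimes\ell}\sqcup\{0\}$ and send $0$ to $0$; products denote composition (rightmost first). Crystal bracketing of letters $j+1$ and $j$ in a sequence: repeatedly pair a $j+1$ with a $j$ immediately to its right in the current sequence and remove the pair; removed letters are bracketed. For $i\in I_0$: apply this to the subsequence of letters $i,i+1$; $f_i$ changes the rightmost unbracketed $i$ to $i+1$, $e_i$ the leftmost unbracketed $i+1$ to $i$ ($0$ if none). $\varphi_i,\varepsilon_i$ are the maximal numbers of applications of $f_i$, $e_i$ giving nonzero results, and $s_i(b)=f_i^m(b)$ if $m=\varphi_i(b)-\varepsilon_i(b)\ge0$,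 $s_i(b)=e_i^{-m}(b)$ if $m<0$. $e_{-1}(b)$ changes the leftmost letter in $\{1,2\}$ to $1$ if it is $2$ (else $0$). For $1<i\le n$: $e_{-i}=s_{i-1}\cdots s_1s_i\cdots s_2\,e_{-1}\,s_2\cdots s_is_1\cdots s_{i-1}$; $\varepsilon_{-i}(b)=\max\{k:e_{-i}^kb\ne0\}$. $b$ is $J$-highest weight if $e_j(b)=0$ for all $j\in J$. Initial $k$-sequence: $b_{p_k},\dots,b_{p_1}$ with $b_{p_k}$ the leftmost $k$ and $b_{p_j}$ the leftmost $j$ to the right of $p_{j+1}$. $k$-bracketed entries of a word $w$: every letter $k$ is $k$-bracketed; for $j=k-1,k-2,\dots,1$ successively, take the subsequence consisting of the $k$-bracketed letters $j+1$ and all letters $j$, perform the crystal bracketing on it; the letters $j$ that get bracketed are the $k$-bracketed $j$'s. Cyclically scanning leftwards from a position $q$ for a letter with a given property means choosing the rightmost such letter strictly to the left of $q$ if one exists, and otherwise the rightmost such letter in the whole word. *)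

theory Defs
  imports Main
begin

text \<open>
  A word is the list of its letters, so positions are counted from 0.
  In \<open>word option\<close> the value \<open>None\<close> plays the role of the extra element 0; all crystal operators
  are total maps on \<open>word option\<close> fixing \<open>None\<close>, so that products of operators are ordinary
  compositions and powers are \<open>(^^)\<close>.
\<close>

type_synonym word = "nat list"

definition words :: "nat \<Rightarrow> nat \<Rightarrow> word set" where
  "words n l = {b. length b = l \<and> set b \<subseteq> {1..n+1}}"


subsection \<open>Crystal bracketing\<close>

text \<open>
  Subsequences of a word \<open>w\<close> are given by increasing lists of positions. \<open>remove_pair j w\<close> removes
  the leftmost adjacent pair consisting of a \<open>j+1\<close> followed by a \<open>j\<close>, if there is one. Since two
  such adjacent pairs are always disjoint, the letters that survive do not depend on the order in
  which pairs are removed; \<open>length ps\<close> rounds are enough to exhaust all pairs.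
\<close>

fun remove_pair :: "nat \<Rightarrow> word \<Rightarrow> nat list \<Rightarrow> nat list" where
  "remove_pair j w (p # q # ps) =
     (if w ! p = j + 1 \<and> w ! q = j then ps else p # remove_pair j w (q # ps))"
| "remove_pair j w ps = ps"

definition unbracketed :: "nat \<Rightarrow> word \<Rightarrow> nat list \<Rightarrow> nat list" where
  "unbracketed j w ps = (remove_pair j w ^^ length ps) ps"

definition bracketed :: "nat \<Rightarrow> word \<Rightarrow> nat list \<Rightarrow> nat set" where
  "bracketed j w ps = set ps - set (unbracketed j w ps)"

definition positions :: "word \<Rightarrow> (nat \<Rightarrow> bool) \<Rightarrow> nat list" where
  "positions w P = filter P [0..<length w]"

definition unbracketed_pair :: "nat \<Rightarrow> word \<Rightarrow> nat list" where
  "unbracketed_pair i w = unbracketed i w (positions w (\<lambda>p. w ! p \<in> {i, i + 1}))"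


subsection \<open>Crystal operators\<close>

definition f_op :: "nat \<Rightarrow> word option \<Rightarrow> word option" where
  "f_op i x = Option.bind x (\<lambda>b.
     let ps = filter (\<lambda>p. b ! p = i) (unbracketed_pair i b)
     in if ps = [] then None else Some (b[last ps := i + 1]))"

definition e_op :: "nat \<Rightarrow> word option \<Rightarrow> word option" where
  "e_op i x = Option.bind x (\<lambda>b.
     let ps = filter (\<lambda>p. b ! p = i + 1) (unbracketed_pair i b)
     in if ps = [] then None else Some (b[hd ps := i]))"

definition phi :: "nat \<Rightarrow> word \<Rightarrow> nat" where
  "phi i b = Max {k. (f_op i ^^ k) (Some b) \<noteq> None}"

definition eps :: "nat \<Rightarrow> word \<Rightarrow> nat" where
  "eps i b = Max {k. (e_op i ^^ k) (Some b) \<noteq> None}"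

definition s_op :: "nat \<Rightarrow> word option \<Rightarrow> word option" where
  "s_op i x = Option.bind x (\<lambda>b.
     if eps i b \<le> phi i b then (f_op i ^^ (phi i b - eps i b)) (Some b)
     else (e_op i ^^ (eps i b - phi i b)) (Some b))"

definition e_neg1 :: "word option \<Rightarrow> word option" where
  "e_neg1 x = Option.bind x (\<lambda>b.
     let ps = positions b (\<lambda>p. b ! p \<in> {1, 2})
     in if ps \<noteq> [] \<and> b ! hd ps = 2 then Some (b[hd ps := 1]) else None)"

definition op_prod :: "('a \<Rightarrow> 'a) list \<Rightarrow> 'a \<Rightarrow> 'a" where
  "op_prod gs = foldr (\<circ>) gs id"

text \<open>\<open>e_neg i\<close> is the operator \<open>e\<close> with index \<open>-i\<close>.\<close>

definition e_neg :: "nat \<Rightarrow> word option \<Rightarrow> word option" where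
  "e_neg i =
     (if i = 1 then e_neg1
      else op_prod (map s_op (rev [1..<i]) @ map s_op (rev [2..<i+1]) @ [e_neg1]
                    @ map s_op [2..<i+1] @ map s_op [1..<i]))"

definition eps_neg :: "nat \<Rightarrow> word \<Rightarrow> nat" where
  "eps_neg i b = Max {k. (e_neg i ^^ k) (Some b) \<noteq> None}"

definition highest_weight :: "nat set \<Rightarrow> word \<Rightarrow> bool" where
  "highest_weight J b \<longleftrightarrow> (\<forall>j\<in>J. e_op j (Some b) = None)"


subsection \<open>Initial sequences, \<open>k\<close>-bracketing and cyclic scanning\<close>

definition is_leftmost :: "word \<Rightarrow> (nat \<Rightarrow> bool) \<Rightarrow> nat \<Rightarrow> bool" where
  "is_leftmost w P q \<longleftrightarrow> q < length w \<and> P q \<and> (\<forall>r<q. \<not> P r)"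

text \<open>Only the values \<open>p 1, ..., p k\<close> matter, and they are uniquely determined.\<close>

definition initial_sequence :: "nat \<Rightarrow> word \<Rightarrow> (nat \<Rightarrow> nat) \<Rightarrow> bool" where
  "initial_sequence k b p \<longleftrightarrow>
     is_leftmost b (\<lambda>q. b ! q = k) (p k) \<and>
     (\<forall>j\<in>{1..<k}. is_leftmost b (\<lambda>q. p (j + 1) < q \<and> b ! q = j) (p j))"

text \<open>\<open>k_bracketed_aux k w d\<close> is the set of positions of the \<open>k\<close>-bracketed letters \<open>k - d\<close> of \<open>w\<close>.\<close>

fun k_bracketed_aux :: "nat \<Rightarrow> word \<Rightarrow> nat \<Rightarrow> nat set" where
  "k_bracketed_aux k w 0 = {p. p < length w \<and> w ! p = k}"
| "k_bracketed_aux k w (Suc d) =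
     (let j = k - Suc d in
      {p \<in> bracketed j w (positions w (\<lambda>p. p \<in> k_bracketed_aux k w d \<or> w ! p = j)). w ! p = j})"

definition k_bracketed :: "nat \<Rightarrow> word \<Rightarrow> nat set" where
  "k_bracketed k w = (\<Union>d<k. k_bracketed_aux k w d)"

text \<open>\<open>t\<close> is the position found when cyclically scanning \<open>w\<close> leftwards from \<open>q\<close> for property \<open>P\<close>.\<close>

definition cyclic_scan_left :: "word \<Rightarrow> nat \<Rightarrow> (nat \<Rightarrow> bool) \<Rightarrow> nat \<Rightarrow> bool" where
  "cyclic_scan_left w q P t \<longleftrightarrow>
     t < length w \<and> P t \<and>
     (if \<exists>r<length w. r < q \<and> P r
      then t < q \<and> (\<forall>r<length w. t < r \<and> r < q \<longrightarrow> \<not> P r)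
      else (\<forall>r<length w. t < r \<longrightarrow> \<not> P r))"

definition lower_along :: "nat \<Rightarrow> (nat \<Rightarrow> nat) \<Rightarrow> word \<Rightarrow> word" where
  "lower_along i p b = fold (\<lambda>j w. w[p j := j - 1]) (rev [2..<i+2]) b"

end

theory Submission
  imports Defs
begin

text \<open>
  On a word all of whose letters \<open>m + 1\<close> are paired, \<open>s\<^sub>m\<close> raises the unpaired letters \<open>m\<close>. Hence
  \<open>s\<^sub>1 \<cdots> s\<^sub>i\<^sub>-\<^sub>1\<close> raises exactly the letters \<open>m < i\<close> of \<open>b\<close> that are not \<open>i\<close>-bracketed; in the resulting
  word \<open>v\<close> the letters \<open>j + 1\<close> still pair with the letters \<open>j\<close> for \<open>2 \<le> j \<le> i\<close>, so \<open>s\<^sub>2 \<cdots> s\<^sub>i\<close> raises the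
  letters \<open>m \<ge> 2\<close> of \<open>v\<close> that are not \<open>(i + 1)\<close>-bracketed. Then \<open>e\<^sub>-\<^sub>1\<close> lowers the leftmost 2, and undoing
  \<open>s\<^sub>2 \<cdots> s\<^sub>i\<close> lowers in \<open>v\<close> the leftmost bracketed letter \<open>q\<^sub>j\<close> of each value \<open>j = i + 1, \<dots>, 2\<close>; call this
  word \<open>v'\<close>.

  Let \<open>c\<^sub>0\<close> be \<open>b\<close> with \<open>p\<^sub>j\<close> lowered to \<open>j - 1\<close> for all \<open>j\<close>, including \<open>p\<^sub>1\<close>. Its \<open>i\<close>-bracketed letters \<open>j\<close> are
  those of \<open>b\<close> with \<open>p\<^sub>j\<close> replaced by \<open>q\<close> of index \<open>j + 1\<close>, and this makes \<open>v'\<close> the word obtained by raising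
  all letters of \<open>c\<^sub>0\<close> that are not \<open>i\<close>-bracketed and writing 1 at \<open>t\<^sub>0 = p\<^sub>1\<close>. The same
  shape persists: \<open>s\<^sub>m \<cdots> s\<^sub>1 v'\<close> arises from \<open>c\<^sub>m\<close> by raising the letters \<open>> m\<close> that are not \<open>i\<close>-bracketed and
  writing \<open>m + 1\<close> at \<open>t\<^sub>m\<close>. Indeed the new letter at \<open>t\<^sub>m\<close> either is not bracketed or pushes a letter
  at some \<open>\<tau> > t\<^sub>m\<close> out of its bracket, with no unbracketed \<open>m + 1\<close> between the two; the unraised letter at
  \<open>\<tau>\<close> pairs with the nearest raised letter to its left, which \<open>s\<^sub>m\<^sub>+\<^sub>1\<close> therefore leaves alone, and if
  there is none then \<open>s\<^sub>m\<^sub>+\<^sub>1\<close> leaves the rightmost one.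
\<close>

section \<open>Pairing as a depth count\<close>

text \<open>\<open>depth A B p\<close> is the number of opening positions in \<open>A\<close> that are still unpaired just before \<open>p\<close>;
  truncated subtraction makes it ignore a closing position in \<open>B\<close> that finds none.\<close>

primrec depth :: "nat set \<Rightarrow> nat set \<Rightarrow> nat \<Rightarrow> nat" where
  "depth A B 0 = 0"
| "depth A B (Suc p) =
     (if p \<in> A then Suc (depth A B p) else if p \<in> B then depth A B p - 1 else depth A B p)"

definition matched :: "nat set \<Rightarrow> nat set \<Rightarrow> nat set" where
  "matched A B = {p \<in> B. 0 < depth A B p}"

lemma matched_subset: "matched A B \<subseteq> B"
  by (auto simp: matched_def)

lemma depth_mono:
  assumes "A' \<subseteq> A" "B \<subseteq> B'" "A \<inter> B' = {}"
  shows "depth A' B' n \<le> depth A B n"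
proof (induction n)
  case (Suc n)
  have "n \<in> A \<Longrightarrow> n \<notin> B'" "n \<in> A' \<Longrightarrow> n \<in> A" "n \<in> B \<Longrightarrow> n \<in> B'"
    using assms by auto
  then show ?case using Suc by auto
qed simp

lemma depth_eq_0:
  assumes "\<And>x. x \<in> A \<Longrightarrow> n \<le> x"
  shows "depth A B n = 0"
  using assms
proof (induction n)
  case (Suc n)
  have "n \<notin> A" using Suc.prems by force
  moreover have "depth A B n = 0" using Suc.IH Suc.prems by force
  ultimately show ?case by simp
qed simp

lemma depth_no_close:
  assumes "a \<le> n" "\<And>x. x \<in> B \<Longrightarrow> a \<le> x \<Longrightarrow> n \<le> x"
  shows "depth A B a \<le> depth A B n"
  using assms
proof (induction n)
  case (Suc n)
  show ?case
  proof (cases "a = Suc n")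
    case False
    then have "a \<le> n" using Suc.prems by simp
    then have "n \<notin> B" using Suc.prems by force
    moreover have "depth A B a \<le> depth A B n"
      using Suc.IH \<open>a \<le> n\<close> Suc.prems(2) by force
    ultimately show ?thesis by simp
  qed simp
qed simp

lemma depth_pos:
  assumes "a \<in> A" "a < n" "\<And>x. x \<in> B \<Longrightarrow> a < x \<Longrightarrow> n \<le> x"
  shows "0 < depth A B n"
proof -
  have "depth A B (Suc a) \<le> depth A B n"
    using assms by (intro depth_no_close) auto
  then show ?thesis using assms(1) by simp
qed

lemma depth_matched: "depth A (matched A B) n = depth A B n"
  by (induction n) (auto simp: matched_def)

text \<open>The openings in \<open>A'\<close> are served first: a closing position is handed on to
  \<open>A - A'\<close> only when nothing in \<open>A'\<close> is unpaired. The total does not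
  depend on which opening a closing position consumes.\<close>

lemma depth_split:
  assumes "A' \<subseteq> A" "A \<inter> B = {}"
  shows "depth A B n = depth A' B n + depth (A - A') (B - matched A' B) n"
  using assms by (induction n) (auto simp: matched_def)

text \<open>A closing position lowers the right side only if its own family has something unpaired,
  but the left side as soon as the union has.\<close>

lemma depth_Un_le:
  assumes "(A \<union> A') \<inter> (B \<union> B') = {}" "A \<inter> A' = {}" "B \<inter> B' = {}"
  shows "depth (A \<union> A') (B \<union> B') n \<le> depth A B n + depth A' B' n"
proof (induction n)
  case (Suc n)
  have "n \<in> A \<Longrightarrow> n \<notin> B \<and> n \<notin> B' \<and> n \<notin> A'" "n \<in> A' \<Longrightarrow> n \<notin> B \<and> n \<notin> B' \<and> n \<notin> A"
    "n \<in> B \<Longrightarrow> n \<notin> B'"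
    using assms by auto
  then show ?case using Suc by auto
qed simp

section \<open>Effect of changing single positions on the pairing\<close>

lemma matched_least:
  assumes "a \<in> A" "\<And>x. x \<in> A \<Longrightarrow> a \<le> x" "m \<in> matched A B" "\<And>x. x \<in> matched A B \<Longrightarrow> m \<le> x"
  shows "a < m" "m \<in> B" "\<And>x. x \<in> B \<Longrightarrow> a < x \<Longrightarrow> m \<le> x"
proof -
  show "m \<in> B" using assms(3) by (simp add: matched_def)
  show am: "a < m"
  proof (rule ccontr)
    assume "\<not> a < m"
    then have "depth A B m = 0" using assms(2) by (intro depth_eq_0) force
    then show False using assms(3) by (simp add: matched_def)
  qed
  fix x assume x: "x \<in> B" "a < x"
  \<comment> \<open>\<open>y\<close> is the first closing position after \<open>a\<close>; nothing
    can have consumed \<open>a\<close> before it, so \<open>y\<close> is matched.\<close>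
  define y where "y = (LEAST y. y \<in> B \<and> a < y)"
  have y: "y \<in> B" "a < y" and "y \<le> x"
    unfolding y_def using LeastI[of "\<lambda>y. y \<in> B \<and> a < y" x] Least_le[of "\<lambda>y. y \<in> B \<and> a < y" x] x by auto
  have "0 < depth A B y"
  proof (rule depth_pos[of a])
    fix z assume "z \<in> B" "a < z"
    then show "y \<le> z" unfolding y_def by (simp add: Least_le)
  qed (use assms(1) y in auto)
  then have "y \<in> matched A B" using y by (simp add: matched_def)
  then show "m \<le> x" using assms(4) \<open>y \<le> x\<close> le_trans by blast
qed

text \<open>As a closing position \<open>a\<close> meets depth 0 and does nothing. The missing
  opening therefore costs one unit of depth from \<open>a\<close> on, until the deletion of
  \<open>m\<close> cancels the loss. This models a letter at \<open>a\<close> moving down one level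
  while the one at \<open>m\<close> leaves that level.\<close>

lemma depth_remove_least:
  assumes "a \<in> A" "\<And>x. x \<in> A \<Longrightarrow> a \<le> x" "m \<in> B" "a < m" "\<And>x. x \<in> B \<Longrightarrow> a < x \<Longrightarrow> m \<le> x"
    and "A \<inter> B = {}"
  shows "depth A B n = depth (A - {a}) (insert a (B - {m})) n + (if a < n \<and> n \<le> m then 1 else 0)"
proof (induction n)
  case (Suc n)
  have am: "n \<in> A \<Longrightarrow> n \<notin> B" using assms(6) by auto
  consider "n < a" | "n = a" | "a < n" "n < m" | "n = m" | "m < n" by linarith
  then show ?case
  proof cases
    case 2
    then have "depth A B n = 0" using assms(2) by (simp add: depth_eq_0)
    then show ?thesis using Suc.IH assms(1,4) 2 by simp
  next
    case 3
    then have "n \<notin> B" using assms(5) by force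
    then show ?thesis using Suc.IH 3 by simp
  next
    case 4
    then have "n \<notin> A" using assms(3,6) by auto
    then show ?thesis using Suc.IH 4 assms(3,4) by simp
  qed (use Suc.IH am assms(4) in simp_all)
qed simp

lemma matched_remove_least:
  assumes "a \<in> A" "\<And>x. x \<in> A \<Longrightarrow> a \<le> x" "m \<in> B" "a < m" "\<And>x. x \<in> B \<Longrightarrow> a < x \<Longrightarrow> m \<le> x"
    and "A \<inter> B = {}"
  shows "matched (A - {a}) (insert a (B - {m})) = matched A B - {m}"
proof -
  note d = depth_remove_least[OF assms]
  have "depth A B a = 0" using assms(2) by (simp add: depth_eq_0)
  then have a: "depth (A - {a}) (insert a (B - {m})) a = 0" using d[of a] by auto
  show ?thesis
  proof (intro set_eqI)
    fix x
    show "x \<in> matched (A - {a}) (insert a (B - {m})) \<longleftrightarrow> x \<in> matched A B - {m}"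
    proof (cases "x = a \<or> x = m")
      case True
      then show ?thesis using a assms(1,4,6) by (auto simp: matched_def)
    next
      case False
      have "x \<in> B \<Longrightarrow> \<not> (a < x \<and> x \<le> m)" using False assms(5) by force
      then show ?thesis using d[of x] False by (auto simp: matched_def)
    qed
  qed
qed

lemma depth_next_close:
  assumes "a \<in> A" "a < n" "depth A B n = 0"
  obtains x where "x \<in> B" "a < x" "x < n"
  using depth_pos[of a A n B] assms by (metis less_numeral_extra(3) not_le_imp_less)

text \<open>The new opening \<open>a0\<close> adds one to the depth up to \<open>m0\<close>: there
  it is absorbed either by a closing position that was ignored before, or by \<open>a\<close>
  itself, which turns from opening to closing. Turning \<open>a\<close> and deleting
  \<open>m\<close> takes one away between \<open>a\<close> and \<open>m\<close>. In the application
  \<open>a0\<close>, \<open>a\<close>, \<open>m\<close>, \<open>m0\<close> are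
  \<open>q (Suc j)\<close>, \<open>p j\<close>, \<open>p (j - 1)\<close>,
  \<open>q j\<close>.\<close>

lemma depth_shift:
  assumes disj: "A \<inter> B = {}" and a: "a \<in> A" "a0 < a" "a0 \<notin> A" "a0 \<notin> B"
    and gap: "\<And>x. x \<in> A \<Longrightarrow> a0 < x \<Longrightarrow> a \<le> x"
    and m: "m \<in> B" "a < m" "\<And>x. x \<in> B \<Longrightarrow> a < x \<Longrightarrow> m \<le> x"
    and m0: "m0 \<in> A \<union> (B - matched A B)" "a0 < m0"
      "\<And>x. x \<in> A \<union> (B - matched A B) \<Longrightarrow> a0 < x \<Longrightarrow> m0 \<le> x"
  shows "m0 \<le> a"
    and "depth (insert a0 (A - {a})) (insert a (B - {m})) n + (if a < n \<and> n \<le> m then 1 else 0) =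
         depth A B n + (if a0 < n \<and> n \<le> m0 then 1 else 0)"
    and "matched (insert a0 (A - {a})) (insert a (B - {m})) = insert m0 (matched A B - {m})"
    and "\<And>x. x \<in> matched A B \<Longrightarrow> m0 < x \<Longrightarrow> m \<le> x"
proof -
  let ?A = "insert a0 (A - {a})" and ?B = "insert a (B - {m})"
  show m0a: "m0 \<le> a" using m0(3)[of a] a by simp
  have mA: "m \<notin> A" using m(1) disj by auto
  have m0_cases: "m0 = a \<or> m0 < a \<and> m0 \<in> B \<and> m0 \<notin> A \<and> depth A B m0 = 0"
    using m0a m0(1,2) gap[of m0] by (auto simp: matched_def)
  \<comment> \<open>If \<open>m0 < a\<close>, then \<open>m0\<close> is an ignored closing position,
    and no opening follows before \<open>a\<close>.\<close>
  have zero: "m0 < x \<Longrightarrow> x \<le> a \<Longrightarrow> depth A B x = 0" for x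
  proof (induction x)
    case (Suc x)
    show ?case
    proof (cases "x = m0")
      case True
      then show ?thesis using m0_cases Suc.prems by auto
    next
      case False
      then have "depth A B x = 0" using Suc by simp
      moreover have "x \<notin> A" using gap[of x] Suc.prems m0(2) False by linarith
      ultimately show ?thesis by simp
    qed
  qed simp
  show d: "depth ?A ?B n + (if a < n \<and> n \<le> m then 1 else 0) =
         depth A B n + (if a0 < n \<and> n \<le> m0 then 1 else 0)" for n
  proof (induction n)
    case (Suc n)
    have am: "n \<in> A \<Longrightarrow> n \<notin> B" using disj by auto
    consider "n < a0" | "n = a0" | "a0 < n" "n < m0" | "n = m0" "m0 < a" | "m0 < n" "n < a"
      | "n = a" "m0 = a" | "n = a" "m0 < a" | "a < n" "n < m" | "n = m" | "m < n"
      using m0a by linarith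
    then show ?case
    proof cases
      case 1
      then show ?thesis using Suc.IH am a(2) m(2) m0(2) by simp
    next
      case 2
      then show ?thesis using Suc.IH a m(2) m0(2) by simp
    next
      case 3
      have "n \<notin> A" using gap[of n] 3 m0a by linarith
      moreover have "0 < depth A B n" if "n \<in> B"
        using m0(3)[of n] 3 that by (auto simp: matched_def)
      ultimately show ?thesis using Suc.IH 3 m0a a m(2) by auto
    next
      case 4
      then show ?thesis using Suc.IH m0_cases m0(2) a m(2) by auto
    next
      case 5
      have "n \<notin> A" using gap[of n] 5 m0 by linarith
      then show ?thesis using Suc.IH zero[of n] 5 m0(2) a m(2) by auto
    next
      case 6
      then show ?thesis using Suc.IH a m(2) m0(2) am by auto
    next
      case 7
      then show ?thesis using Suc.IH zero[of a] a m(2) m0(2) am by auto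
    next
      case 8
      have "n \<notin> B" using m(3)[of n] 8 by linarith
      then show ?thesis using Suc.IH 8 m0a a m(2) m0(2) by auto
    next
      case 9
      then show ?thesis using Suc.IH m0a a m m0(2) mA by auto
    next
      case 10
      then show ?thesis using Suc.IH m0a a m(2) m0(2) am by auto
    qed
  qed simp
  show "matched ?A ?B = insert m0 (matched A B - {m})"
  proof (intro set_eqI)
    fix x
    consider "x = m" | "x = m0" | "x = a" "m0 < a" | "x \<noteq> m" "x \<noteq> m0" "x \<noteq> a"
      using m0a by linarith
    then show "x \<in> matched ?A ?B \<longleftrightarrow> x \<in> insert m0 (matched A B - {m})"
    proof cases
      case 1
      then show ?thesis using m(2) m0a by (simp add: matched_def)
    next
      case 2
      have "0 < depth ?A ?B m0" using d[of m0] m0(2) m0a by simp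
      then show ?thesis using 2 m0_cases m(2) by (auto simp: matched_def)
    next
      case 3
      then have "depth ?A ?B a = 0" using d[of a] zero[of a] by simp
      then show ?thesis using 3 a(1) disj by (auto simp: matched_def)
    next
      case 4
      have "x \<in> B \<Longrightarrow> \<not> (a < x \<and> x \<le> m)" using m(3)[of x] 4 by linarith
      moreover have "0 < depth A B x" if "x \<in> B" "a0 < x" "x \<le> m0"
        using m0(3)[of x] that 4 by (auto simp: matched_def)
      ultimately show ?thesis using d[of x] 4 by (auto simp: matched_def split: if_splits)
    qed
  qed
  show "m \<le> x" if "x \<in> matched A B" "m0 < x" for x
  proof (rule m(3))
    show "x \<in> B" using that by (simp add: matched_def)
    then have "x \<noteq> a" using disj a(1) by auto
    moreover have "\<not> x < a" using zero[of x] that by (auto simp: matched_def)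
    ultimately show "a < x" by simp
  qed
qed

text \<open>Here \<tau> is the closing position that loses its partner because of \<open>t\<close>.
  It is \<open>t\<close> itself if nothing is unpaired there; otherwise it is the step at which the
  old depth first returns to 0 after \<open>t\<close>, which happens because the depth is 0 at
  \<open>L\<close>. Closing positions between the two have old depth at least 2 and stay
  matched.\<close>

lemma matched_insert:
  assumes "t \<notin> A" "t \<notin> B" "A \<inter> B = {}" "depth A B L = 0" "t < L"
  obtains \<tau> where "t \<le> \<tau>" "\<tau> < L" "\<tau> = t \<or> \<tau> \<in> matched A B" "depth A (insert t B) \<tau> = 0"
    "matched A (insert t B) = insert t (matched A B) - {\<tau>}"
    "\<And>x. x \<in> B \<Longrightarrow> t < x \<Longrightarrow> x < \<tau> \<Longrightarrow> x \<in> matched A B"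
proof (cases "depth A B t = 0")
  case True
  have d: "depth A (insert t B) n = depth A B n" for n
    using True assms(1,2) by (induction n) auto
  show thesis
    by (rule that[of t]) (use True assms in \<open>auto simp: matched_def d\<close>)
next
  case False
  define y where "y = (LEAST y. t < y \<and> depth A B y = 0)"
  have y: "t < y" "depth A B y = 0" "y \<le> L"
    using LeastI[of "\<lambda>y. t < y \<and> depth A B y = 0" L] Least_le[of "\<lambda>y. t < y \<and> depth A B y = 0" L] assms(4,5)
    by (auto simp: y_def)
  then obtain \<tau> where \<tau>: "y = Suc \<tau>" by (cases y) auto
  have pos: "0 < depth A B x" if "t \<le> x" "x \<le> \<tau>" for x
    using not_less_Least[of x "\<lambda>y. t < y \<and> depth A B y = 0", folded y_def] that \<tau> False
    by (cases "x = t") auto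
  have "depth A B t = depth A B (Suc t)" using assms(1,2) by simp
  then have "\<tau> \<noteq> t" using False y(2) \<tau> by auto
  then have t\<tau>: "t < \<tau>" using y(1) \<tau> by simp
  have "0 < depth A B \<tau>" using pos t\<tau> by simp
  then have \<tau>B: "\<tau> \<in> B" "\<tau> \<notin> A" and \<tau>1: "depth A B \<tau> = 1"
    using y(2) \<tau> by (auto split: if_splits)
  have d: "depth A B n = depth A (insert t B) n + (if t < n \<and> n \<le> \<tau> then 1 else 0)" for n
  proof (induction n)
    case (Suc n)
    consider "n < t" | "n = t" | "t < n" "n < \<tau>" | "n = \<tau>" | "\<tau> < n" by linarith
    then show ?case
    proof cases
      case 2
      then show ?thesis using Suc.IH False assms(1,2) t\<tau> by auto
    next
      case 3
      then show ?thesis using Suc.IH pos[of "Suc n"] by auto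
    next
      case 4
      then show ?thesis using Suc.IH t\<tau> \<tau>1 \<tau>B by auto
    qed (use Suc.IH t\<tau> in auto)
  qed simp
  have B: "1 < depth A B x" if "x \<in> B" "t < x" "x < \<tau>" for x
    using pos[of "Suc x"] that assms(3) by (auto split: if_splits)
  show thesis
  proof (rule that[of \<tau>])
    show "\<tau> < L" using y(3) \<tau> by simp
    show "depth A (insert t B) \<tau> = 0" using d[of \<tau>] t\<tau> \<tau>1 by simp
    show "matched A (insert t B) = insert t (matched A B) - {\<tau>}"
    proof (intro set_eqI)
      fix x
      consider "x = t" | "x = \<tau>" | "t < x" "x < \<tau>" | "x < t \<or> \<tau> < x" by linarith
      then show "x \<in> matched A (insert t B) \<longleftrightarrow> x \<in> insert t (matched A B) - {\<tau>}"
      proof cases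
        case 1
        then show ?thesis using d[of t] False t\<tau> by (auto simp: matched_def)
      next
        case 2
        then show ?thesis using d[of \<tau>] t\<tau> \<tau>1 by (auto simp: matched_def)
      next
        case 3
        then show ?thesis using d[of x] B[of x] by (auto simp: matched_def)
      next
        case 4
        then show ?thesis using d[of x] t\<tau> by (auto simp: matched_def)
      qed
    qed
    show "x \<in> matched A B" if "x \<in> B" "t < x" "x < \<tau>" for x
      using B that by (force simp: matched_def)
  qed (use t\<tau> \<tau>B \<tau>1 in \<open>auto simp: matched_def\<close>)
qed

text \<open>Every position of \<open>B\<close> already has a partner, so none before
  \<open>t\<close> takes the new opening \<open>s\<close>.\<close>

lemma depth_insert_pair:
  assumes "s < t" "s \<notin> A \<union> B" "t \<notin> A \<union> B" "\<And>x. x \<in> B \<Longrightarrow> 0 < depth A B x"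
  shows "depth (insert s A) (insert t B) n = depth A B n + (if s < n \<and> n \<le> t then 1 else 0)"
proof (induction n)
  case (Suc n)
  consider "n < s" | "n = s" | "s < n" "n < t" | "n = t" | "t < n" by linarith
  then show ?case
    by cases (use Suc.IH assms(1-3) assms(4)[of n] in auto)
qed simp

section \<open>Bracketing and the reflections\<close>

text \<open>A stack with its top at the head. One pass from left to right leaves the unbracketed
  positions in reverse order, which replaces the iteration of \<open>remove_pair\<close> by an
  induction along the word.\<close>

definition push :: "nat \<Rightarrow> word \<Rightarrow> nat list \<Rightarrow> nat \<Rightarrow> nat list" where
  "push j w st p = (if st \<noteq> [] \<and> w ! hd st = j + 1 \<and> w ! p = j then tl st else p # st)"

text \<open>The two members of a removed pair are pushed and popped in immediate succession.\<close>

lemma foldl_push_remove_pair: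
  "foldl (push j w) st (remove_pair j w ps) = foldl (push j w) st ps"
  by (induction j w ps arbitrary: st rule: remove_pair.induct) (auto simp: push_def)

lemma remove_pair_shortens: "remove_pair j w ps = ps \<or> length (remove_pair j w ps) < length ps"
  by (induction j w ps rule: remove_pair.induct) auto

lemma remove_pair_funpow_fixpoint:
  "length ps \<le> n \<Longrightarrow> remove_pair j w ((remove_pair j w ^^ n) ps) = (remove_pair j w ^^ n) ps"
proof (induction n arbitrary: ps)
  case (Suc n)
  show ?case
  proof (cases "remove_pair j w ps = ps")
    case True
    then have "(remove_pair j w ^^ m) ps = ps" for m by (induction m) auto
    then show ?thesis using True by simp
  next
    case False
    then have "length (remove_pair j w ps) \<le> n"
      using remove_pair_shortens[of j w ps] Suc.prems by auto
    then show ?thesis using Suc.IH by (simp only: funpow_Suc_right o_apply)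
  qed
qed simp

lemma foldl_push_fixpoint:
  assumes "remove_pair j w ps = ps"
    and "st = [] \<or> ps = [] \<or> \<not> (w ! hd st = j + 1 \<and> w ! hd ps = j)"
  shows "foldl (push j w) st ps = rev ps @ st"
  using assms
proof (induction j w ps arbitrary: st rule: remove_pair.induct)
  case (1 j w p q ps)
  have ne: "\<not> (w ! p = j + 1 \<and> w ! q = j)"
  proof
    assume "w ! p = j + 1 \<and> w ! q = j"
    then have "ps = p # q # ps" using 1(2) by simp
    then have "length ps = length (p # q # ps)" by (rule arg_cong)
    then show False by simp
  qed
  have "push j w st p = p # st" using 1(3) by (auto simp: push_def)
  moreover have "remove_pair j w (q # ps) = q # ps" using 1(2) ne by (simp split: if_splits)
  moreover note 1(1)[OF ne calculation(2), of "p # st"]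
  ultimately show ?case using ne by simp
qed (auto simp: push_def)

lemma unbracketed_eq_stack: "unbracketed j w ps = rev (foldl (push j w) [] ps)"
proof -
  have "foldl (push j w) [] ((remove_pair j w ^^ n) ps) = foldl (push j w) [] ps" for n
    by (induction n) (auto simp: foldl_push_remove_pair)
  then have "foldl (push j w) [] (unbracketed j w ps) = foldl (push j w) [] ps"
    by (simp add: unbracketed_def)
  then show ?thesis
    using foldl_push_fixpoint[of j w "unbracketed j w ps" "[]"]
      remove_pair_funpow_fixpoint[of ps "length ps" j w]
    by (simp add: unbracketed_def rev_swap[symmetric])
qed

text \<open>A letter \<open>j\<close> is never pushed onto a \<open>j + 1\<close>, so the stack
  always consists of open letters \<open>j + 1\<close> on top of unbracketed letters
  \<open>j\<close>, and the height of the upper part is the depth.\<close>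

lemma stack_depth:
  assumes "A = {p. p < length w \<and> P p \<and> w ! p = j + 1}" "B = {p. p < length w \<and> P p \<and> w ! p = j}"
    and "\<And>p. P p \<Longrightarrow> p < length w \<Longrightarrow> w ! p \<in> {j, j + 1}" and "n \<le> length w"
  shows "\<exists>as zs. foldl (push j w) [] (filter P [0..<n]) = as @ zs \<and> length as = depth A B n \<and>
    set as \<subseteq> A \<and> set zs = {p \<in> B. p < n \<and> depth A B p = 0}"
  using assms(4)
proof (induction n)
  case (Suc n)
  then obtain as zs where IH: "foldl (push j w) [] (filter P [0..<n]) = as @ zs"
    "length as = depth A B n" "set as \<subseteq> A" "set zs = {p \<in> B. p < n \<and> depth A B p = 0}"
    by auto
  have witness: ?case if "foldl (push j w) [] (filter P [0..<Suc n]) = as' @ zs'"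
    "length as' = depth A B (Suc n)" "set as' \<subseteq> A" "set zs' = {p \<in> B. p < Suc n \<and> depth A B p = 0}" for as' zs'
    by (intro exI[of _ as'] exI[of _ zs'] conjI that)
  have n: "n < length w" using Suc.prems by simp
  have less_Suc: "{p \<in> B. p < Suc n \<and> Q p} = {p \<in> B. p < n \<and> Q p} \<union> {p. p = n \<and> n \<in> B \<and> Q n}" for Q
    by (auto simp: less_Suc_eq)
  consider "n \<in> A" "n \<notin> B" "P n" "w ! n = j + 1" | "n \<in> B" "n \<notin> A" "P n" "w ! n = j"
    | "n \<notin> A" "n \<notin> B" "\<not> P n"
    using assms(1-3) n by fastforce
  then show ?case
  proof cases
    case 1
    have "foldl (push j w) [] (filter P [0..<Suc n]) = (n # as) @ zs"
      using 1 IH(1) by (simp add: push_def)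
    moreover have "length (n # as) = depth A B (Suc n)" using 1(1) IH(2) by simp
    moreover have "set (n # as) \<subseteq> A" using 1(1) IH(3) by simp
    moreover have "set zs = {p \<in> B. p < Suc n \<and> depth A B p = 0}"
      unfolding less_Suc using IH(4) 1(2) by simp
    ultimately show ?thesis by (rule witness)
  next
    case 2
    show ?thesis
    proof (cases as)
      case Nil
      have "\<not> (zs \<noteq> [] \<and> w ! hd zs = j + 1)"
      proof
        assume "zs \<noteq> [] \<and> w ! hd zs = j + 1"
        then have "hd zs \<in> B" "w ! hd zs = j + 1" using hd_in_set[of zs] unfolding IH(4) by blast+
        then show False unfolding assms(2) by simp
      qed
      then have "foldl (push j w) [] (filter P [0..<Suc n]) = [] @ (n # zs)"
        using 2 IH(1) Nil by (auto simp: push_def)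
      moreover have "length [] = depth A B (Suc n)" using 2(1,2) IH(2) Nil by simp
      moreover have "set [] \<subseteq> A" by simp
      moreover have "set (n # zs) = {p \<in> B. p < Suc n \<and> depth A B p = 0}"
        unfolding less_Suc using IH(2,4) 2(1) Nil by simp
      ultimately show ?thesis by (rule witness)
    next
      case (Cons a as')
      have "w ! a = j + 1" using Cons IH(3) assms(1) by auto
      then have "foldl (push j w) [] (filter P [0..<Suc n]) = as' @ zs"
        using 2 IH(1) Cons by (simp add: push_def)
      moreover have "length as' = depth A B (Suc n)" using 2(1,2) IH(2)[symmetric] Cons by simp
      moreover have "set as' \<subseteq> A" using IH(3) Cons by simp
      moreover have "set zs = {p \<in> B. p < Suc n \<and> depth A B p = 0}"
        unfolding less_Suc using IH(2)[symmetric] IH(4) Cons by simp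
      ultimately show ?thesis by (rule witness)
    qed
  next
    case 3
    have "foldl (push j w) [] (filter P [0..<Suc n]) = as @ zs" using 3(3) IH(1) by simp
    moreover have "length as = depth A B (Suc n)" using 3(1,2) IH(2) by simp
    moreover note IH(3)
    moreover have "set zs = {p \<in> B. p < Suc n \<and> depth A B p = 0}"
      unfolding less_Suc using IH(4) 3(2) by simp
    ultimately show ?thesis by (rule witness)
  qed
qed simp

lemma bracketed_eq_matched:
  assumes "\<And>p. P p \<Longrightarrow> p < length w \<Longrightarrow> w ! p \<in> {j, j + 1}"
  shows "{p \<in> bracketed j w (positions w P). w ! p = j} =
    matched {p. p < length w \<and> P p \<and> w ! p = j + 1} {p. p < length w \<and> P p \<and> w ! p = j}"
    (is "_ = matched ?A ?B")
proof -
  obtain as zs where *: "foldl (push j w) [] (positions w P) = as @ zs"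
    "set as \<subseteq> ?A" "set zs = {p \<in> ?B. p < length w \<and> depth ?A ?B p = 0}"
    using stack_depth[where w = w and P = P and j = j, OF refl refl assms order_refl]
    unfolding positions_def by auto
  have "p \<notin> set as" if "w ! p = j" for p using *(2) that by auto
  then show ?thesis
    using *(1,3) by (auto simp: bracketed_def unbracketed_eq_stack matched_def positions_def)
qed

lemma highest_weight_depth:
  assumes "e_op j (Some w) = None"
  shows "depth {p. p < length w \<and> w ! p = j + 1} {p. p < length w \<and> w ! p = j} (length w) = 0"
    (is "depth ?A ?B _ = 0")
proof -
  have AB: "?A = {p. p < length w \<and> w ! p \<in> {j, j + 1} \<and> w ! p = j + 1}"
    "?B = {p. p < length w \<and> w ! p \<in> {j, j + 1} \<and> w ! p = j}" by auto
  obtain as zs where *: "foldl (push j w) [] (positions w (\<lambda>p. w ! p \<in> {j, j + 1})) = as @ zs"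
    "length as = depth ?A ?B (length w)" "set as \<subseteq> ?A"
    using stack_depth[OF AB _ order_refl] unfolding positions_def by auto
  have "filter (\<lambda>p. w ! p = j + 1) (as @ zs) = []"
    using assms *(1)
    by (simp add: e_op_def Let_def unbracketed_pair_def unbracketed_eq_stack rev_filter[symmetric] split: if_splits)
  then have "as = []" using *(3) by (cases as) auto
  then show ?thesis using *(2) by simp
qed

section \<open>Words as functions on positions, and the action of one reflection\<close>

definition word_of :: "nat \<Rightarrow> (nat \<Rightarrow> nat) \<Rightarrow> word" where
  "word_of L f = map f [0..<L]"

lemma length_word_of [simp]: "length (word_of L f) = L"
  by (simp add: word_of_def)

lemma nth_word_of [simp]: "p < L \<Longrightarrow> word_of L f ! p = f p"
  by (simp add: word_of_def)

lemma word_of_update: "(word_of L f)[p := x] = word_of L (f(p := x))"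
  by (rule nth_equalityI) (auto simp: nth_list_update)

lemma word_of_cong: "(\<And>p. p < L \<Longrightarrow> f p = g p) \<Longrightarrow> word_of L f = word_of L g"
  by (simp add: word_of_def)

definition letters :: "nat \<Rightarrow> (nat \<Rightarrow> nat) \<Rightarrow> nat \<Rightarrow> nat set" where
  "letters L f j = {p. p < L \<and> f p = j}"

text \<open>Certifies that \<open>Z\<close> is the set of unbracketed positions: the other letters \<open>j + 1\<close> and \<open>j\<close>
  pair off completely and no element of \<open>Z\<close> lies between two paired letters.\<close>

locale unpaired =
  fixes L j :: nat and f :: "nat \<Rightarrow> nat" and Z :: "nat set"
  assumes Z_less: "Z \<subseteq> {..<L}"
    and closed: "p \<in> letters L f j - Z \<Longrightarrow> 0 < depth (letters L f (j + 1) - Z) (letters L f j - Z) p"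
    and end_depth: "depth (letters L f (j + 1) - Z) (letters L f j - Z) L = 0"
    and Z_depth: "z \<in> Z \<Longrightarrow> depth (letters L f (j + 1) - Z) (letters L f j - Z) z = 0"
begin

abbreviation "opens \<equiv> letters L f (j + 1) - Z"
abbreviation "closes \<equiv> letters L f j - Z"

text \<open>By the third assumption no \<open>j + 1\<close> precedes a \<open>j\<close> inside
  \<open>Z\<close>, so elements of \<open>Z\<close> never pair with each other; by
  \<open>Z_depth\<close> no open letter from outside is on the stack when one of them is
  read.\<close>

lemma stack:
  assumes w: "\<And>p. p < L \<Longrightarrow> p \<notin> Z \<Longrightarrow> w ! p = f p"
    and Zw: "\<And>z. z \<in> Z \<Longrightarrow> w ! z \<in> {j, j + 1}"
    and ord: "\<And>y z. y \<in> Z \<Longrightarrow> z \<in> Z \<Longrightarrow> y < z \<Longrightarrow> w ! y = j + 1 \<Longrightarrow> w ! z = j + 1"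
    and "n \<le> L"
  shows "\<exists>as. foldl (push j w) [] (filter (\<lambda>p. w ! p \<in> {j, j + 1}) [0..<n]) = as @ rev (filter (\<lambda>p. p \<in> Z) [0..<n])
    \<and> length as = depth opens closes n \<and> set as \<subseteq> opens"
  using assms(4)
proof (induction n)
  case (Suc n)
  let ?F = "\<lambda>n. filter (\<lambda>p. w ! p \<in> {j, j + 1}) [0..<n]"
  let ?Z = "\<lambda>n. rev (filter (\<lambda>p. p \<in> Z) [0..<n])"
  obtain as where IH: "foldl (push j w) [] (?F n) = as @ ?Z n"
    "length as = depth opens closes n" "set as \<subseteq> opens" using Suc by auto
  have n: "n < L" using Suc.prems by simp
  consider "n \<in> opens" "n \<notin> closes" "n \<notin> Z" "w ! n = j + 1" | "n \<in> closes" "n \<notin> opens" "n \<notin> Z" "w ! n = j"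
    | "n \<in> Z" | "n \<notin> opens" "n \<notin> closes" "n \<notin> Z" "w ! n \<notin> {j, j + 1}"
    using w n by (fastforce simp: letters_def)
  then show ?case
  proof cases
    case 1
    then have "push j w (as @ ?Z n) n = (n # as) @ ?Z n" by (simp add: push_def)
    then show ?thesis using 1 IH by (intro exI[of _ "n # as"]) simp
  next
    case 2
    then have "0 < length as" using closed IH(2) by simp
    then obtain a as' where as: "as = a # as'" by (cases as) auto
    then have "w ! a = j + 1" using IH(3) w by (auto simp: letters_def)
    then have "push j w (as @ ?Z n) n = as' @ ?Z n" using 2 as by (simp add: push_def)
    then show ?thesis using 2 IH as by (intro exI[of _ as']) auto
  next
    case 3
    then have "as = []" using Z_depth IH(2) by simp
    moreover have "push j w (?Z n) n = n # ?Z n"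
    proof -
      have False if "?Z n \<noteq> []" "w ! hd (?Z n) = j + 1" "w ! n = j"
      proof -
        have "hd (?Z n) \<in> set (?Z n)" using that(1) by (rule hd_in_set)
        then show False using ord[of "hd (?Z n)" n] 3 that by auto
      qed
      then show ?thesis by (auto simp: push_def)
    qed
    ultimately show ?thesis using 3 IH Zw[of n] by (intro exI[of _ "[]"]) auto
  next
    case 4
    then show ?thesis using IH by (intro exI[of _ as]) simp
  qed
qed simp

lemma unbracketed_pair_eq:
  assumes "length w = L" "\<And>p. p < L \<Longrightarrow> p \<notin> Z \<Longrightarrow> w ! p = f p"
    and "\<And>z. z \<in> Z \<Longrightarrow> w ! z \<in> {j, j + 1}"
    and "\<And>y z. y \<in> Z \<Longrightarrow> z \<in> Z \<Longrightarrow> y < z \<Longrightarrow> w ! y = j + 1 \<Longrightarrow> w ! z = j + 1"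
  shows "unbracketed_pair j w = filter (\<lambda>p. p \<in> Z) [0..<L]"
  using stack[where w = w and n = L, OF assms(2-4) order_refl] end_depth assms(1)
  by (auto simp: unbracketed_pair_def unbracketed_eq_stack positions_def)

definition zs :: "nat list" where
  "zs = filter (\<lambda>p. p \<in> Z) [0..<L]"

text \<open>The unbracketed letters of a word read \<open>a\<close> letters \<open>j\<close>
  followed by letters \<open>j + 1\<close>. With everything outside \<open>Z\<close> fixed,
  \<open>a\<close> is the coordinate along the string on which \<open>e_op j\<close> and
  \<open>f_op j\<close> move.\<close>

definition state :: "nat \<Rightarrow> word" where
  "state a = word_of L (\<lambda>p. if p \<in> set (take a zs) then j else if p \<in> Z then j + 1 else f p)"

lemma zs_props: "set zs = Z" "distinct zs" "sorted zs"
  using Z_less by (auto simp: zs_def intro: sorted_wrt_filter)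

lemma zs_split:
  "set (take a zs) \<inter> set (drop a zs) = {}" "set (take a zs) \<union> set (drop a zs) = Z"
  using zs_props set_append[of "take a zs" "drop a zs"] distinct_append[of "take a zs" "drop a zs"]
  by auto

lemma unbracketed_pair_state: "unbracketed_pair j (state a) = zs"
  unfolding zs_def
proof (rule unbracketed_pair_eq)
  have tZ: "set (take a zs) \<subseteq> Z" using zs_split by auto
  have L: "z \<in> Z \<Longrightarrow> z < L" for z using Z_less by auto
  show "state a ! p = f p" if "p < L" "p \<notin> Z" for p
    using that tZ by (auto simp: state_def)
  show "state a ! z \<in> {j, j + 1}" if "z \<in> Z" for z
    using that L[of z] by (auto simp: state_def)
  show "state a ! z = j + 1" if "y \<in> Z" "z \<in> Z" "y < z" "state a ! y = j + 1" for y z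
  proof -
    have "y \<notin> set (take a zs)" using that L by (auto simp: state_def)
    then have "y \<in> set (drop a zs)" using that zs_split by blast
    have "z \<notin> set (take a zs)"
    proof
      assume "z \<in> set (take a zs)"
      then have "z \<le> y"
        using \<open>y \<in> set (drop a zs)\<close> zs_props(3) sorted_append[of "take a zs" "drop a zs"] by simp
      then show False using that by simp
    qed
    then show ?thesis using that L[of z] by (simp add: state_def)
  qed
qed (simp add: state_def)

lemma filter_state:
  "filter (\<lambda>p. state a ! p = j) zs = take a zs" "filter (\<lambda>p. state a ! p = j + 1) zs = drop a zs"
proof -
  have L: "z \<in> Z \<Longrightarrow> z < L" for z using Z_less by auto
  have t: "state a ! z = j" if "z \<in> set (take a zs)" for z
  proof -
    have "z < L" using that L zs_split(2)[of a] by blast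
    then show ?thesis using that by (simp add: state_def)
  qed
  have d: "state a ! z = j + 1" if "z \<in> set (drop a zs)" for z
  proof -
    have "z < L" "z \<in> Z" "z \<notin> set (take a zs)" using that L zs_split[of a] by blast+
    then show ?thesis by (simp add: state_def)
  qed
  have *: "filter P zs = filter P (take a zs) @ filter P (drop a zs)" for P
    by (metis append_take_drop_id filter_append)
  show "filter (\<lambda>p. state a ! p = j) zs = take a zs" "filter (\<lambda>p. state a ! p = j + 1) zs = drop a zs"
    using t d by (auto simp: * filter_id_conv filter_empty_conv)
qed

lemma state_Suc:
  assumes "a < length zs"
  shows "state (Suc a) = (state a)[zs ! a := j]" "state a = (state (Suc a))[zs ! a := j + 1]"
proof -
  have t: "set (take (Suc a) zs) = insert (zs ! a) (set (take a zs))"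
    using assms by (simp add: take_Suc_conv_app_nth)
  have a: "zs ! a \<in> Z" using assms zs_props(1) nth_mem by metis
  have "zs ! a \<notin> set (take a zs)"
    using zs_split(1)[of a] assms by (metis Cons_nth_drop_Suc disjoint_iff list.set_intros(1))
  then show "state (Suc a) = (state a)[zs ! a := j]" "state a = (state (Suc a))[zs ! a := j + 1]"
    unfolding state_def word_of_update using t a by (auto intro!: word_of_cong)
qed

lemma e_op_state: "e_op j (Some (state a)) = (if a < length zs then Some (state (Suc a)) else None)"
  using state_Suc(1)[of a] by (auto simp: e_op_def Let_def unbracketed_pair_state filter_state filter_state(2)[simplified] hd_drop_conv_nth)

lemma f_op_state:
  "a \<le> length zs \<Longrightarrow> f_op j (Some (state a)) = (if a = 0 then None else Some (state (a - 1)))"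
proof (cases a)
  case (Suc c)
  assume "a \<le> length zs"
  then have "take a zs \<noteq> []" "last (take a zs) = zs ! c" using Suc by (auto simp: take_Suc_conv_app_nth)
  then show ?thesis using state_Suc(2)[of c] Suc \<open>a \<le> length zs\<close>
    by (simp add: f_op_def Let_def unbracketed_pair_state filter_state)
qed (auto simp: f_op_def Let_def unbracketed_pair_state filter_state)

lemma e_op_funpow: "(e_op j ^^ k) (Some (state a)) = (if k = 0 \<or> a + k \<le> length zs then Some (state (a + k)) else None)"
proof (induction k)
  case (Suc k)
  have "e_op j None = None" by (simp add: e_op_def)
  then show ?case using Suc e_op_state[of "a + k"] by auto
qed simp

lemma f_op_funpow:
  "a \<le> length zs \<Longrightarrow> (f_op j ^^ k) (Some (state a)) = (if k \<le> a then Some (state (a - k)) else None)"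
proof (induction k)
  case (Suc k)
  have "f_op j None = None" by (simp add: f_op_def)
  then show ?case using Suc f_op_state[of "a - k"] by auto
qed simp

text \<open>On this string \<open>phi\<close> equals \<open>a\<close> and \<open>eps\<close> equals
  \<open>length zs - a\<close>, so moving by their difference is reflection in the middle.\<close>

lemma s_op_state:
  assumes "a \<le> length zs"
  shows "s_op j (Some (state a)) = Some (state (length zs - a))"
proof -
  have Max: "Max {..n} = n" for n :: nat by (rule Max_eqI) auto
  have "{k. (e_op j ^^ k) (Some (state a)) \<noteq> None} = {..length zs - a}"
    using assms by (auto simp: e_op_funpow)
  then have eps: "eps j (state a) = length zs - a" by (simp add: eps_def Max)
  have "{k. (f_op j ^^ k) (Some (state a)) \<noteq> None} = {..a}"
    using assms by (auto simp: f_op_funpow)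
  then have phi: "phi j (state a) = a" by (simp add: phi_def Max)
  show ?thesis
    using assms by (auto simp: s_op_def eps phi e_op_funpow f_op_funpow)
qed

lemma s_op_swap_all:
  "s_op j (Some (word_of L (\<lambda>p. if p \<in> Z then j else f p))) =
     Some (word_of L (\<lambda>p. if p \<in> Z then j + 1 else f p))"
  "s_op j (Some (word_of L (\<lambda>p. if p \<in> Z then j + 1 else f p))) =
     Some (word_of L (\<lambda>p. if p \<in> Z then j else f p))"
proof -
  have "state (length zs) = word_of L (\<lambda>p. if p \<in> Z then j else f p)"
    "state 0 = word_of L (\<lambda>p. if p \<in> Z then j + 1 else f p)"
    by (auto simp: state_def zs_props intro!: word_of_cong)
  then show "s_op j (Some (word_of L (\<lambda>p. if p \<in> Z then j else f p))) =
     Some (word_of L (\<lambda>p. if p \<in> Z then j + 1 else f p))"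
  "s_op j (Some (word_of L (\<lambda>p. if p \<in> Z then j + 1 else f p))) =
     Some (word_of L (\<lambda>p. if p \<in> Z then j else f p))"
    using s_op_state[of "length zs"] s_op_state[of 0] by simp_all
qed

text \<open>The string reflection at \<open>a = 1\<close>: a single \<open>j\<close> at the left end
  becomes a single \<open>j + 1\<close> at the right end. This is the source of the cyclic
  wrap-around in the scan.\<close>

lemma s_op_swap_one:
  assumes "Z \<noteq> {}"
  shows "s_op j (Some (word_of L (\<lambda>p. if p = Min Z then j else if p \<in> Z then j + 1 else f p))) =
     Some (word_of L (\<lambda>p. if p = Max Z then j + 1 else if p \<in> Z then j else f p))"
proof -
  have ne: "zs \<noteq> []" using assms zs_props(1) by auto
  have fin: "finite Z" using zs_props(1) by (metis List.finite_set)
  have "Min Z = hd zs"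
    using zs_props ne fin by (metis Min_eqI hd_in_set list.collapse set_ConsD sorted_simps(2) order_refl)
  then have min: "set (take 1 zs) = {Min Z}" using ne by (cases zs) auto
  have bl: "butlast zs @ [last zs] = zs" using ne by simp
  have "Max Z = last zs"
  proof (rule Max_eqI)
    fix y assume "y \<in> Z"
    then have "y \<in> set (butlast zs @ [last zs])" using bl zs_props(1) by metis
    moreover have "sorted (butlast zs @ [last zs])" using bl zs_props(3) by metis
    ultimately show "y \<le> last zs" by (auto simp del: append_butlast_last_id simp: sorted_append)
  next
    show "last zs \<in> Z" using ne zs_props(1) last_in_set by metis
  qed (rule fin)
  moreover have "last zs \<notin> set (butlast zs)"
    using bl zs_props(2) distinct_append[of "butlast zs" "[last zs]"] by auto
  moreover have "insert (last zs) (set (butlast zs)) = Z"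
    using arg_cong[OF bl, of set] zs_props(1) by (simp del: append_butlast_last_id)
  ultimately have "set (butlast zs) = Z - {Max Z}" by (metis Diff_insert_absorb)
  then have max: "set (take (length zs - 1) zs) = Z - {Max Z}" by (simp add: butlast_conv_take)
  have "Max Z \<in> Z" "Min Z \<in> Z" using assms fin by simp_all
  then have "state 1 = word_of L (\<lambda>p. if p = Min Z then j else if p \<in> Z then j + 1 else f p)"
    "state (length zs - 1) = word_of L (\<lambda>p. if p = Max Z then j + 1 else if p \<in> Z then j else f p)"
    unfolding state_def min max by (auto intro!: word_of_cong)
  moreover have "1 \<le> length zs" using ne by (cases zs) auto
  ultimately show ?thesis using s_op_state[of 1] by simp
qed

end

section \<open>Raising the letters that are not bracketed\<close>

text \<open>\<open>kbr L k f j\<close> is the set of \<open>k\<close>-bracketed letters \<open>j\<close>; levels are computed downwards from \<open>k\<close>.\<close>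

primrec bracket_level :: "nat \<Rightarrow> nat \<Rightarrow> (nat \<Rightarrow> nat) \<Rightarrow> nat \<Rightarrow> nat set" where
  "bracket_level L k f 0 = letters L f k"
| "bracket_level L k f (Suc d) = matched (bracket_level L k f d) (letters L f (k - Suc d))"

definition kbr :: "nat \<Rightarrow> nat \<Rightarrow> (nat \<Rightarrow> nat) \<Rightarrow> nat \<Rightarrow> nat set" where
  "kbr L k f j = bracket_level L k f (k - j)"

text \<open>The intended value of the product of \<open>s_op lo\<close>, ...,
  \<open>s_op (k - 1)\<close> on \<open>f\<close>; see \<open>s_op_chain\<close> for the
  condition.\<close>

definition raised :: "nat \<Rightarrow> nat \<Rightarrow> nat \<Rightarrow> (nat \<Rightarrow> nat) \<Rightarrow> nat \<Rightarrow> nat" where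
  "raised L k lo f = (\<lambda>p. if lo \<le> f p \<and> f p < k \<and> p \<notin> kbr L k f (f p) then Suc (f p) else f p)"

lemma kbr_top: "kbr L k f k = letters L f k"
  by (simp add: kbr_def)

lemma kbr_step: "j < k \<Longrightarrow> kbr L k f j = matched (kbr L k f (Suc j)) (letters L f j)"
proof -
  assume "j < k"
  then have "k - j = Suc (k - Suc j)" "k - Suc (k - Suc j) = j" by auto
  then show ?thesis by (simp add: kbr_def)
qed

lemma kbr_subset: "j \<le> k \<Longrightarrow> kbr L k f j \<subseteq> letters L f j"
  using kbr_top kbr_step matched_subset by (metis le_neq_implies_less order_refl)

lemma kbrD: "p \<in> kbr L k f j \<Longrightarrow> j \<le> k \<Longrightarrow> p < L \<and> f p = j"
  using kbr_subset by (fastforce simp: letters_def)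

lemma letters_disjoint: "j \<noteq> j' \<Longrightarrow> letters L f j \<inter> letters L f j' = {}"
  by (auto simp: letters_def)

text \<open>Levels are computed from \<open>k\<close> downwards, so letters below \<open>j\<close>
  have no influence on level \<open>j\<close>.\<close>

lemma kbr_cong:
  assumes "\<And>j'. j \<le> j' \<Longrightarrow> j' \<le> k \<Longrightarrow> letters L f j' = letters L g j'" and "j \<le> k"
  shows "kbr L k f j = kbr L k g j"
  using assms(2,1)
proof (induction j rule: inc_induct)
  case base
  then show ?case by (simp add: kbr_top)
next
  case (step n)
  then have "kbr L k f (Suc n) = kbr L k g (Suc n)" by simp
  then show ?case using step by (simp add: kbr_step)
qed

lemma k_bracketed_aux_eq: "d \<le> k \<Longrightarrow> k_bracketed_aux k (word_of L f) d = bracket_level L k f d"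
proof (induction d)
  case 0
  then show ?case by (auto simp: letters_def)
next
  case (Suc d)
  let ?w = "word_of L f" and ?j = "k - Suc d" and ?K = "k_bracketed_aux k (word_of L f) d"
  have "?K = kbr L k f (Suc ?j)" using Suc by (simp add: kbr_def Suc_diff_Suc)
  then have K: "p \<in> ?K \<Longrightarrow> p < L \<and> f p = Suc ?j" for p
    using kbrD[of p L k f "Suc ?j"] Suc.prems by auto
  have "k_bracketed_aux k ?w (Suc d) =
    matched {p. p < L \<and> (p \<in> ?K \<or> ?w ! p = ?j) \<and> ?w ! p = ?j + 1}
      {p. p < L \<and> (p \<in> ?K \<or> ?w ! p = ?j) \<and> ?w ! p = ?j}"
    unfolding k_bracketed_aux.simps Let_def
    by (subst bracketed_eq_matched) (use K in auto)
  also have "{p. p < L \<and> (p \<in> ?K \<or> ?w ! p = ?j) \<and> ?w ! p = ?j + 1} = ?K"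
    using K by auto
  also have "{p. p < L \<and> (p \<in> ?K \<or> ?w ! p = ?j) \<and> ?w ! p = ?j} = letters L f ?j"
    by (auto simp: letters_def)
  finally show ?case using Suc by simp
qed

lemma k_bracketed_iff:
  assumes "1 \<le> m" "m \<le> k" "q < L" "f q = m"
  shows "q \<in> k_bracketed k (word_of L f) \<longleftrightarrow> q \<in> kbr L k f m"
proof
  assume "q \<in> k_bracketed k (word_of L f)"
  then obtain d where d: "d < k" "q \<in> k_bracketed_aux k (word_of L f) d"
    by (auto simp: k_bracketed_def)
  then have "q \<in> kbr L k f (k - d)" by (simp add: k_bracketed_aux_eq kbr_def)
  then show "q \<in> kbr L k f m" using kbrD[of q L k f "k - d"] assms(4) by simp
next
  assume "q \<in> kbr L k f m"
  then have "q \<in> k_bracketed_aux k (word_of L f) (k - m)"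
    by (simp add: k_bracketed_aux_eq kbr_def)
  moreover have "k - m < k" using assms(1,2) by simp
  ultimately show "q \<in> k_bracketed k (word_of L f)" unfolding k_bracketed_def by blast
qed

lemma letters_raised:
  assumes "m < k"
  shows "letters L (raised L k (Suc m) f) m = letters L f m"
    and "letters L (raised L k (Suc m) f) (Suc m) = kbr L k f (Suc m)"
proof -
  show "letters L (raised L k (Suc m) f) m = letters L f m"
    by (auto simp: letters_def raised_def split: if_splits)
  show "letters L (raised L k (Suc m) f) (Suc m) = kbr L k f (Suc m)"
  proof (intro set_eqI)
    fix p
    have "p \<in> kbr L k f (Suc m) \<Longrightarrow> p < L \<and> f p = Suc m" using kbrD assms by auto
    moreover have "p \<in> kbr L k f (Suc m) \<longleftrightarrow> p < L \<and> f p = Suc m" if "k = Suc m"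
      using that kbr_top[of L k f] by (auto simp: letters_def)
    ultimately show "p \<in> letters L (raised L k (Suc m) f) (Suc m) \<longleftrightarrow> p \<in> kbr L k f (Suc m)"
      using assms by (cases "k = Suc m") (auto simp: letters_def raised_def)
  qed
qed

text \<open>After the raising only bracketed letters \<open>Suc m\<close> are left as openings, and
  the letters \<open>m\<close> which they match are by definition the bracketed ones.\<close>

lemma unpaired_raised:
  assumes "m < k" "depth (kbr L k f (Suc m)) (letters L f m) L = 0"
  shows "unpaired L m (raised L k (Suc m) f) (letters L f m - kbr L k f m)"
proof -
  let ?g = "raised L k (Suc m) f" and ?Z = "letters L f m - kbr L k f m"
  have sub: "kbr L k f (Suc m) \<subseteq> letters L f (Suc m)" "kbr L k f m \<subseteq> letters L f m"
    using assms(1) by (simp_all add: kbr_subset)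
  have 1: "letters L ?g (m + 1) - ?Z = kbr L k f (Suc m)"
    using letters_raised[OF assms(1)] sub letters_disjoint[of m "Suc m" L f] by auto
  have 2: "letters L ?g m - ?Z = kbr L k f m"
    using letters_raised[OF assms(1)] sub by auto
  have d: "depth (kbr L k f (Suc m)) (kbr L k f m) n = depth (kbr L k f (Suc m)) (letters L f m) n" for n
    using assms(1) by (simp add: kbr_step[of m] depth_matched)
  show ?thesis
  proof (unfold_locales, unfold 1 2 d)
    show "?Z \<subseteq> {..<L}" by (auto simp: letters_def)
    show "0 < depth (kbr L k f (Suc m)) (letters L f m) p" if "p \<in> kbr L k f m" for p
      using that assms(1) by (simp add: kbr_step[of m] matched_def)
    show "depth (kbr L k f (Suc m)) (letters L f m) z = 0" if "z \<in> ?Z" for z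
      using that assms(1) by (simp add: kbr_step[of m] matched_def)
  qed (rule assms(2))
qed

lemma s_op_raised:
  assumes "m < k" "depth (kbr L k f (Suc m)) (letters L f m) L = 0"
  shows "s_op m (Some (word_of L (raised L k (Suc m) f))) = Some (word_of L (raised L k m f))"
    and "s_op m (Some (word_of L (raised L k m f))) = Some (word_of L (raised L k (Suc m) f))"
proof -
  let ?Z = "letters L f m - kbr L k f m"
  interpret unpaired L m "raised L k (Suc m) f" ?Z by (rule unpaired_raised[OF assms])
  have "raised L k (Suc m) f p = (if p \<in> ?Z then m else raised L k (Suc m) f p)"
    "raised L k m f p = (if p \<in> ?Z then m + 1 else raised L k (Suc m) f p)" if "p < L" for p
    using assms(1) that by (cases "f p = m"; simp add: raised_def letters_def Suc_le_eq)+
  then have "word_of L (raised L k (Suc m) f) = word_of L (\<lambda>p. if p \<in> ?Z then m else raised L k (Suc m) f p)"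
    "word_of L (raised L k m f) = word_of L (\<lambda>p. if p \<in> ?Z then m + 1 else raised L k (Suc m) f p)"
    by (auto intro!: word_of_cong simp del: if_split)
  then show "s_op m (Some (word_of L (raised L k (Suc m) f))) = Some (word_of L (raised L k m f))"
    "s_op m (Some (word_of L (raised L k m f))) = Some (word_of L (raised L k (Suc m) f))"
    using s_op_swap_all by simp_all
qed

section \<open>One step of the cyclic scan\<close>

lemma cyclic_scan_left_cong:
  assumes "\<And>q. q < length w \<Longrightarrow> P q = Q q"
  shows "cyclic_scan_left w s P t = cyclic_scan_left w s Q t"
proof -
  have "(\<exists>r<length w. r < s \<and> P r) = (\<exists>r<length w. r < s \<and> Q r)"
    "(\<forall>r<length w. t < r \<and> r < s \<longrightarrow> \<not> P r) = (\<forall>r<length w. t < r \<and> r < s \<longrightarrow> \<not> Q r)"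
    "(\<forall>r<length w. t < r \<longrightarrow> \<not> P r) = (\<forall>r<length w. t < r \<longrightarrow> \<not> Q r)"
    using assms by blast+
  moreover have "(t < length w \<and> P t \<and> R) = (t < length w \<and> Q t \<and> R)" for R
    using assms by blast
  ultimately show ?thesis unfolding cyclic_scan_left_def by presburger
qed

text \<open>Inductive step of the algorithm. In \<open>c\<close> the letter at \<open>t\<close> is
  still below \<open>M\<close>, hence invisible to the levels from \<open>M\<close> up;
  \<open>c'\<close> writes the pending \<open>M\<close> there. The new position \<open>t'\<close> is
  left in the same situation one level higher. The hypothesis \<open>sat\<close> says that every
  bracketed \<open>Suc j\<close> finds a partner \<open>j\<close>.\<close>

lemma scan_step:
  assumes M: "1 \<le> M" "M < k" and t: "t < L" "c t < M"
    and sat: "\<And>j. M \<le> j \<Longrightarrow> j < k \<Longrightarrow> depth (kbr L k c (Suc j)) (letters L c j) L = 0"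
    and c': "c' = c(t := M)"
  obtains t' where "t' < L" "c' t' = M"
    "cyclic_scan_left (word_of L c') t
       (\<lambda>q. word_of L c' ! q = M \<and> q \<notin> k_bracketed k (word_of L c')) t'"
    "s_op M (Some (word_of L ((raised L k M c)(t := M)))) =
       Some (word_of L ((raised L k (Suc M) c')(t' := Suc M)))"
    "\<And>j. Suc M \<le> j \<Longrightarrow> j < k \<Longrightarrow> depth (kbr L k c' (Suc j)) (letters L c' j) L = 0"
proof -
  have let_M: "letters L c' M = insert t (letters L c M)"
    using t by (auto simp: c' letters_def)
  have let_gt: "letters L c' j = letters L c j" if "M < j" for j
    using t that by (auto simp: c' letters_def)
  have K_gt: "kbr L k c' j = kbr L k c j" if "M < j" "j \<le> k" for j
    using that by (intro kbr_cong let_gt) auto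
  let ?A = "kbr L k c (Suc M)" and ?K = "kbr L k c' M" and ?g = "raised L k (Suc M) c'"
  have A: "?A \<subseteq> letters L c (Suc M)" using M by (simp add: kbr_subset)
  have K: "kbr L k c M = matched ?A (letters L c M)" "?K = matched ?A (insert t (letters L c M))"
    using M K_gt[of "Suc M"] by (simp_all add: kbr_step let_M)
  have tA: "t \<notin> ?A" "t \<notin> letters L c M" "?A \<inter> letters L c M = {}"
    using A t(2) by (auto simp: letters_def)
  \<comment> \<open>The letter \<open>M\<close> at \<open>t\<close> is a new closing position
    against the bracketed letters \<open>Suc M\<close>; \<tau> is the \<open>M\<close> that ends up
    without a partner.\<close>
  obtain \<tau> where \<tau>: "t \<le> \<tau>" "\<tau> < L" "\<tau> = t \<or> \<tau> \<in> kbr L k c M"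
    "depth ?A (insert t (letters L c M)) \<tau> = 0" "?K = insert t (kbr L k c M) - {\<tau>}"
    "\<And>x. x \<in> letters L c M \<Longrightarrow> t < x \<Longrightarrow> x < \<tau> \<Longrightarrow> x \<in> kbr L k c M"
    using matched_insert[OF tA sat[OF order_refl M(2)] t(1)] unfolding K by metis
  define N where "N = letters L c' M - ?K"
  have \<tau>M: "c' \<tau> = M" using \<tau>(3) kbrD[of \<tau> L k c M] M by (auto simp: c')
  have \<tau>N: "\<tau> \<in> N" using \<tau>M \<tau>(2,5) by (auto simp: N_def letters_def)
  have N_gap: "x \<notin> N" if "t \<le> x" "x < \<tau>" for x
    using that \<tau>(5,6) by (cases "x = t") (auto simp: N_def let_M)
  have N_iff: "q \<in> N \<longleftrightarrow> word_of L c' ! q = M \<and> q \<notin> k_bracketed k (word_of L c')" if "q < L" for q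
    using that k_bracketed_iff[of M k q L c'] M by (auto simp: N_def letters_def)
  have scanI: "cyclic_scan_left (word_of L c') t
      (\<lambda>q. word_of L c' ! q = M \<and> q \<notin> k_bracketed k (word_of L c')) s"
    if "s < L" "s \<in> N" "if \<exists>r<L. r < t \<and> r \<in> N then s < t \<and> (\<forall>r<L. s < r \<and> r < t \<longrightarrow> r \<notin> N)
      else \<forall>r<L. s < r \<longrightarrow> r \<notin> N" for s
  proof -
    have "cyclic_scan_left (word_of L c') t (\<lambda>q. q \<in> N) s"
      using that unfolding cyclic_scan_left_def length_word_of by blast
    moreover note cyclic_scan_left_cong[of "word_of L c'" "\<lambda>q. q \<in> N", unfolded length_word_of, OF N_iff]
    ultimately show ?thesis by blast
  qed
  have NL: "q < L" "c' q = M" "q \<notin> ?K" if "q \<in> N" for q using that by (auto simp: N_def letters_def)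
  have finN: "finite N" using NL(1) by (intro finite_subset[of N "{..<L}"]) auto
  have sat': "depth (kbr L k c' (Suc j)) (letters L c' j) L = 0" if "M \<le> j" "j < k" for j
  proof (cases "j = M")
    case True
    \<comment> \<open>An additional letter \<open>M\<close> can only lower the final depth.\<close>
    have "depth ?A (letters L c' M) L \<le> depth ?A (letters L c M) L"
      using tA by (intro depth_mono) (auto simp: let_M)
    then show ?thesis using True sat[of M] K_gt[of "Suc M"] M by simp
  next
    case False
    then show ?thesis using that sat K_gt let_gt by simp
  qed
  \<comment> \<open>Compared with \<open>raised L k M c'\<close> only \<tau> is left unraised. If
    \<tau> is \<open>t\<close>, this is the explicit \<open>M\<close> written there; otherwise
    \<open>t\<close> is bracketed in \<open>c'\<close>, while \<tau> was bracketed in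
    \<open>c\<close>.\<close>
  have V: "word_of L ((raised L k M c)(t := M)) =
      word_of L (\<lambda>p. if p = \<tau> then M else if p \<in> N then Suc M else ?g p)"
  proof (rule word_of_cong)
    fix p assume p: "p < L"
    have cp: "c' p = c p" if "p \<noteq> t" using that by (simp add: c')
    show "((raised L k M c)(t := M)) p = (if p = \<tau> then M else if p \<in> N then Suc M else ?g p)"
    proof (cases "p = t")
      case True
      then have "t \<notin> N" if "t \<noteq> \<tau>" using N_gap \<tau>(1) that by simp
      moreover have "?g t = M" by (simp add: raised_def c')
      ultimately show ?thesis using True by auto
    next
      case False
      consider "p = \<tau>" | "p \<noteq> \<tau>" "c p = M" | "p \<noteq> \<tau>" "c p < M \<or> k < c p" | "p \<noteq> \<tau>" "M < c p" "c p \<le> k" by linarith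
      then show ?thesis
      proof cases
        case 1
        then have "p \<in> kbr L k c M" "c p = M" using \<tau>(3) \<tau>M False cp by auto
        then show ?thesis using 1 False by (simp add: raised_def)
      next
        case 2
        have "p \<in> letters L c' M" using 2(2) cp[OF False] p by (simp add: letters_def)
        then have "p \<in> N \<longleftrightarrow> p \<notin> kbr L k c M" unfolding N_def \<tau>(5) using 2(1) False by blast
        then show ?thesis using 2 False M(2) cp[OF False] by (simp add: raised_def)
      next
        case 3
        then have "p \<notin> N" using NL(2)[of p] cp[OF False] M by auto
        then show ?thesis using 3 False cp[OF False] by (auto simp: raised_def)
      next
        case 4
        then have "p \<notin> N" using NL(2)[of p] cp[OF False] 4 by auto
        then show ?thesis using 4 False cp[OF False] K_gt[of "c p"] by (simp add: raised_def)
      qed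
    qed
  qed
  have gN: "?g p = M" if "p \<in> N" for p using NL(2)[OF that] by (simp add: raised_def)
  interpret all: unpaired L M ?g N
    unfolding N_def by (rule unpaired_raised[OF M(2) sat'[OF order_refl M(2)]])
  show thesis
  proof (cases "\<exists>x\<in>N. x < \<tau>")
    \<comment> \<open>Now the lone \<open>M\<close> at \<tau> stands left of all letters
      \<open>Suc M\<close> in \<open>N\<close>, so the reflection keeps only the rightmost
      \<open>Suc M\<close>. The scan finds nothing left of \<open>t\<close> and wraps around to the
      same position.\<close>
    case False
    then have min: "Min N = \<tau>" using finN \<tau>N by (intro Min_eqI) auto
    have ne: "N \<noteq> {}" using \<tau>N by auto
    let ?t = "Max N"
    have tN: "?t \<in> N" using finN \<tau>N by (intro Max_in) auto
    have max: "x \<le> ?t" if "x \<in> N" for x using finN that by simp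
    show thesis
    proof (rule that[of ?t])
      have "\<not> (\<exists>r<L. r < t \<and> r \<in> N)" using False \<tau>(1) by auto
      then show "cyclic_scan_left (word_of L c') t
       (\<lambda>q. word_of L c' ! q = M \<and> q \<notin> k_bracketed k (word_of L c')) ?t"
        using NL(1)[OF tN] tN max leD by (intro scanI) auto
      have "word_of L (?g(?t := Suc M)) = word_of L (\<lambda>p. if p = Max N then M + 1 else if p \<in> N then M else ?g p)"
        using gN by (auto intro!: word_of_cong)
      then show "s_op M (Some (word_of L ((raised L k M c)(t := M)))) = Some (word_of L (?g(?t := Suc M)))"
        using all.s_op_swap_one[OF ne] unfolding V min Suc_eq_plus1 by simp
    qed (use NL tN sat' in auto)
  next
    case True
    \<comment> \<open>The element of \<open>N\<close> nearest to \<tau> on the left. Since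
      \<open>N\<close> has no element from \<open>t\<close> up to just before \<tau>, it lies left
      of \<open>t\<close> and is also what the scan from \<open>t\<close> finds.\<close>
    define s where "s = Max {x \<in> N. x < \<tau>}"
    have "s \<in> {x \<in> N. x < \<tau>}" using finN True unfolding s_def by (intro Max_in) auto
    then have tN: "s \<in> N" "s < \<tau>" by auto
    have max: "x \<le> s" if "x \<in> N" "x < \<tau>" for x using finN that unfolding s_def by (intro Max_ge) auto
    have tt: "s < t" using N_gap[of s] tN by linarith
    \<comment> \<open>The \<open>Suc M\<close> at \<open>s\<close> pairs with the \<open>M\<close>
      at \<tau>, so both drop out of the unbracketed positions; the reflection lowers all the
      others, and \<open>s\<close> keeps its \<open>Suc M\<close>.\<close>
    let ?Z = "N - {\<tau>, s}" and ?f = "?g(s := Suc M)"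
    have KA: "kbr L k c' (Suc M) = ?A" using K_gt M by simp
    have letters: "letters L ?g (Suc M) = ?A" "letters L ?g M = letters L c' M"
      using letters_raised[OF M(2), of L c'] KA by simp_all
    have K_sub: "?K \<subseteq> letters L c' M" using M by (simp add: kbr_subset)
    have AN: "?A \<inter> N = {}"
    proof -
      have False if "q \<in> ?A" "q \<in> N" for q
        using kbrD[OF that(1)] NL(2)[OF that(2)] M t(2) by (simp add: c' split: if_splits)
      then show ?thesis by blast
    qed
    have 1: "letters L ?f (M + 1) - ?Z = insert s ?A"
    proof -
      have "letters L ?f (M + 1) = insert s (letters L ?g (Suc M))"
        using NL(1)[OF tN(1)] by (auto simp: letters_def)
      then show ?thesis using letters AN by auto
    qed
    have 2: "letters L ?f M - ?Z = insert \<tau> ?K"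
    proof -
      have "letters L ?f M = letters L ?g M - {s}" by (auto simp: letters_def)
      moreover have "s \<notin> ?K" using NL(3) tN by simp
      moreover have "\<tau> \<noteq> s" using tN by simp
      moreover have "letters L c' M = N \<union> ?K" using K_sub by (auto simp: N_def)
      moreover have "N \<inter> ?K = {}" by (auto simp: N_def)
      ultimately show ?thesis using letters \<tau>N by blast
    qed
    have opens: "letters L ?g (M + 1) - N = ?A" using letters AN by auto
    have closes: "letters L ?g M - N = ?K" using letters K_sub by (auto simp: N_def)
    have d: "depth (insert s ?A) (insert \<tau> ?K) n = depth ?A ?K n + (if s < n \<and> n \<le> \<tau> then 1 else 0)" for n
    proof (rule depth_insert_pair)
      show "s \<notin> ?A \<union> ?K" "\<tau> \<notin> ?A \<union> ?K" using AN tN \<tau>N NL(3) by auto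
      show "0 < depth ?A ?K x" if "x \<in> ?K" for x using all.closed[of x] that unfolding opens closes by simp
    qed (rule tN)
    interpret one: unpaired L M ?f ?Z
    proof (unfold_locales, unfold 1 2 d)
      show "?Z \<subseteq> {..<L}" using NL(1) by auto
      show "0 < depth ?A ?K p + (if s < p \<and> p \<le> \<tau> then 1 else 0)" if "p \<in> insert \<tau> ?K" for p
        using that all.closed[of p] tN unfolding opens closes by auto
      show "depth ?A ?K L + (if s < L \<and> L \<le> \<tau> then 1 else 0) = 0"
        using all.end_depth \<tau>(2) unfolding opens closes by simp
      show "depth ?A ?K z + (if s < z \<and> z \<le> \<tau> then 1 else 0) = 0" if "z \<in> ?Z" for z
      proof -
        have z: "z \<in> N" "z \<noteq> \<tau>" "z \<noteq> s" using that by auto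
        then have "\<not> (s < z \<and> z \<le> \<tau>)" using max[of z] by linarith
        then show ?thesis using all.Z_depth[OF z(1)] unfolding opens closes by simp
      qed
    qed
    show thesis
    proof (rule that[of s])
      have "\<exists>r<L. r < t \<and> r \<in> N" using NL(1)[OF tN(1)] tN(1) tt by blast
      moreover have "r \<notin> N" if "s < r" "r < t" for r
      proof
        assume "r \<in> N"
        then have "r \<le> s" using that(2) \<tau>(1) by (intro max) linarith+
        then show False using that(1) by simp
      qed
      ultimately show "cyclic_scan_left (word_of L c') t
       (\<lambda>q. word_of L c' ! q = M \<and> q \<notin> k_bracketed k (word_of L c')) s"
        using NL(1)[OF tN(1)] tN(1) tt by (intro scanI) auto
      have "word_of L ?f = word_of L (\<lambda>p. if p \<in> ?Z then M else ?f p)"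
        using gN by (auto intro!: word_of_cong)
      moreover have "word_of L ((raised L k M c)(t := M)) = word_of L (\<lambda>p. if p \<in> ?Z then M + 1 else ?f p)"
        unfolding V using gN[OF \<tau>N] tN by (auto intro!: word_of_cong)
      ultimately show "s_op M (Some (word_of L ((raised L k M c)(t := M)))) = Some (word_of L ?f)"
        using one.s_op_swap_all(2) by simp
    qed (use NL tN sat' in auto)
  qed
qed

section \<open>The word before the last reflections\<close>

lemma op_prod_simps: "op_prod [] x = x" "op_prod (g # gs) x = g (op_prod gs x)"
  "op_prod (gs @ hs) x = op_prod gs (op_prod hs x)"
proof -
  show *: "op_prod [] x = x" "\<And>g gs. op_prod (g # gs) x = g (op_prod gs x)"
    by (simp_all add: op_prod_def)
  show "op_prod (gs @ hs) x = op_prod gs (op_prod hs x)"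
    by (induction gs) (simp_all add: op_prod_def)
qed

lemma raised_self: "raised L k k f = f"
  by (auto simp: raised_def)

lemma s_op_chain:
  assumes "lo \<le> k" "\<And>j. lo \<le> j \<Longrightarrow> j < k \<Longrightarrow> depth (kbr L k f (Suc j)) (letters L f j) L = 0"
  shows "op_prod (map s_op [lo..<k]) (Some (word_of L f)) = Some (word_of L (raised L k lo f))"
    and "op_prod (map s_op (rev [lo..<k])) (Some (word_of L (raised L k lo f))) = Some (word_of L f)"
proof -
  have "op_prod (map s_op [lo..<k]) (Some (word_of L f)) = Some (word_of L (raised L k lo f)) \<and>
    op_prod (map s_op (rev [lo..<k])) (Some (word_of L (raised L k lo f))) = Some (word_of L f)"
    using assms
  proof (induction lo rule: inc_induct)
    case base
    then show ?case by (simp add: op_prod_simps raised_self)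
  next
    case (step n)
    then have "[n..<k] = n # [Suc n..<k]" by (simp add: upt_rec)
    then show ?case using step s_op_raised[of n k L f] by (simp add: op_prod_simps)
  qed
  then show "op_prod (map s_op [lo..<k]) (Some (word_of L f)) = Some (word_of L (raised L k lo f))"
    "op_prod (map s_op (rev [lo..<k])) (Some (word_of L (raised L k lo f))) = Some (word_of L f)"
    by simp_all
qed

text \<open>The operator acts only if the leftmost letter among 1 and 2 is a 2, which is then the
  leftmost 2.\<close>

lemma e_neg1_word_of:
  assumes "e_neg1 (Some (word_of L u)) \<noteq> None"
  shows "letters L u 2 \<noteq> {}"
    and "e_neg1 (Some (word_of L u)) = Some (word_of L (u(Min (letters L u 2) := 1)))"
proof -
  define ps where "ps = positions (word_of L u) (\<lambda>p. word_of L u ! p \<in> {1, 2})"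
  have ps: "ps \<noteq> []" "word_of L u ! hd ps = 2"
    and e: "e_neg1 (Some (word_of L u)) = Some ((word_of L u)[hd ps := 1])"
    using assms by (auto simp: e_neg1_def ps_def Let_def split: if_splits)
  have set: "set ps = {p. p < L \<and> u p \<in> {1, 2}}" by (auto simp: ps_def positions_def)
  have "sorted ps" unfolding ps_def positions_def by (intro sorted_wrt_filter) simp
  then have le: "hd ps \<le> p" if "p \<in> set ps" for p using that ps(1) by (cases ps) auto
  have "hd ps \<in> set ps" using ps(1) by simp
  then have hd: "hd ps \<in> letters L u 2" using ps(2) set by (auto simp: letters_def)
  then show "letters L u 2 \<noteq> {}" by auto
  have "finite (letters L u 2)" by (simp add: letters_def)
  then have "Min (letters L u 2) = hd ps"
    using hd le set by (intro Min_eqI) (auto simp: letters_def)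
  then show "e_neg1 (Some (word_of L u)) = Some (word_of L (u(Min (letters L u 2) := 1)))"
    using e by (simp add: word_of_update)
qed

text \<open>The initial sequence, indexed by the distance \<open>d\<close> from the letter
  \<open>k\<close>. Each \<open>LEAST\<close> is meaningful only once such a position is known to
  exist.\<close>

primrec first_descent :: "nat \<Rightarrow> nat \<Rightarrow> (nat \<Rightarrow> nat) \<Rightarrow> nat \<Rightarrow> nat" where
  "first_descent L k f 0 = (LEAST x. x \<in> letters L f k)"
| "first_descent L k f (Suc d) = (LEAST x. first_descent L k f d < x \<and> x \<in> letters L f (k - Suc d))"

section \<open>The first two chains of reflections on a highest weight word\<close>

locale highest =
  fixes L i :: nat and f :: "nat \<Rightarrow> nat"
  assumes i: "1 \<le> i"
    and hw: "\<And>j. 1 \<le> j \<Longrightarrow> j \<le> i \<Longrightarrow> depth (letters L f (Suc j)) (letters L f j) L = 0"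
begin

abbreviation "K \<equiv> kbr L i f"

definition "v = raised L i 1 f"

abbreviation "K' \<equiv> kbr L (Suc i) v"

definition "u = raised L (Suc i) 2 v"

lemma sat_f:
  assumes "1 \<le> j" "j < i"
  shows "depth (K (Suc j)) (letters L f j) L = 0"
proof -
  have "depth (K (Suc j)) (letters L f j) L \<le> depth (letters L f (Suc j)) (letters L f j) L"
    using assms by (intro depth_mono kbr_subset letters_disjoint) auto
  then show ?thesis using hw assms by simp
qed

lemma letters_v:
  assumes "2 \<le> j" "j \<le> i"
  shows "letters L v j = K j \<union> (letters L f (j - 1) - K (j - 1))"
proof (intro set_eqI)
  fix x
  have K: "x \<in> K j \<Longrightarrow> x < L" "x \<in> K j \<Longrightarrow> f x = j" using kbrD[of x L i f j] assms by auto
  have top: "x \<in> K j \<longleftrightarrow> x < L" if "j = i" "f x = j" using that by (simp add: kbr_top letters_def)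
  have j: "j \<noteq> j - 1" "1 \<le> j - 1" "j - 1 < i" "Suc (j - 1) = j" using assms by auto
  consider "f x = j" | "f x = j - 1" | "f x \<noteq> j" "f x \<noteq> j - 1" by blast
  then show "x \<in> letters L v j \<longleftrightarrow> x \<in> K j \<union> (letters L f (j - 1) - K (j - 1))"
  proof cases
    case 1
    then have "v x = (if j < i \<and> x \<notin> K j then Suc j else j)"
      using assms by (simp add: v_def raised_def)
    moreover have "x \<notin> letters L f (j - 1)" using 1 j(1) by (simp add: letters_def)
    ultimately show ?thesis using K(1) top[OF _ 1] assms by (cases "j = i") (auto simp: letters_def)
  next
    case 2
    then have "v x = (if x \<notin> K (j - 1) then j else j - 1)"
      using j by (simp add: v_def raised_def)
    moreover have "x \<notin> K j" using K(2) 2 j(1) by auto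
    ultimately show ?thesis using 2 j(1) by (auto simp: letters_def)
  next
    case 3
    have "v x \<noteq> j"
    proof
      assume "v x = j"
      then have "f x = j \<or> Suc (f x) = j" by (simp add: v_def raised_def split: if_splits)
      then show False using 3 by auto
    qed
    then show ?thesis using 3 K(2) by (auto simp: letters_def)
  qed
qed

lemma letters_v_top: "letters L v (Suc i) = letters L f (Suc i)"
  by (auto simp: letters_def v_def raised_def)

text \<open>For \<open>j < i\<close> the letters of \<open>v\<close> are split into those that
  stayed and those that were raised, and \<open>depth_Un_le\<close> treats the families separately.
  The first pairs off by \<open>sat_f\<close>. The second consists of the unbracketed
  \<open>j\<close> and \<open>j - 1\<close> of \<open>f\<close>; by \<open>depth_split\<close> its
  depth is a summand of the full depth of \<open>j\<close> against \<open>j - 1\<close>, which is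
  0.\<close>

lemma hw_v:
  assumes "2 \<le> j" "j \<le> i"
  shows "depth (letters L v (Suc j)) (letters L v j) L = 0"
proof (cases "j = i")
  case True
  have "K i \<subseteq> letters L v i" using letters_v[of i] assms by auto
  then have "letters L f i \<subseteq> letters L v i" by (simp add: kbr_top)
  then have "depth (letters L v (Suc i)) (letters L v i) L \<le> depth (letters L f (Suc i)) (letters L f i) L"
    using letters_disjoint[of "Suc i" i L v] by (intro depth_mono) (simp_all add: letters_v_top)
  then show ?thesis using hw[of i] i True by simp
next
  case False
  then have j: "j < i" using assms by simp
  define A A' B B' where "A = K (Suc j)" and "A' = letters L f j - K j" and "B = K j"
    and "B' = letters L f (j - 1) - K (j - 1)"
  have K: "K (Suc j) \<subseteq> letters L f (Suc j)" "K j \<subseteq> letters L f j"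
    using j by (simp_all add: kbr_subset)
  have v: "letters L v (Suc j) = A \<union> A'" "letters L v j = B \<union> B'"
    using letters_v[of "Suc j"] letters_v[of j] j assms by (simp_all add: A_def A'_def B_def B'_def)
  have disj: "letters L f j \<inter> letters L f (j - 1) = {}" using assms by (intro letters_disjoint) simp
  have "depth (A \<union> A') (B \<union> B') L \<le> depth A B L + depth A' B' L"
  proof (rule depth_Un_le)
    show "(A \<union> A') \<inter> (B \<union> B') = {}" unfolding v[symmetric] by (rule letters_disjoint) simp
    show "A \<inter> A' = {}" using K letters_disjoint[of j "Suc j" L f] by (auto simp: A_def A'_def)
    show "B \<inter> B' = {}" using K disj by (auto simp: B_def B'_def)
  qed
  moreover have "depth A B L = 0"
    using sat_f[of j] assms j by (simp add: A_def B_def kbr_step[of j] depth_matched)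
  moreover have "depth A' B' L = 0"
  proof -
    have "B' = letters L f (j - 1) - matched (K j) (letters L f (j - 1))"
      using assms j kbr_step[of "j - 1" i L f] by (simp add: B'_def)
    then have "depth A' B' L \<le> depth (letters L f j) (letters L f (j - 1)) L"
      using depth_split[OF K(2) disj, of L] by (simp add: A'_def)
    then show ?thesis using hw[of "j - 1"] assms by simp
  qed
  ultimately show ?thesis by (simp add: v)
qed

lemma sat_v:
  assumes "2 \<le> j" "j < Suc i"
  shows "depth (K' (Suc j)) (letters L v j) L = 0"
proof -
  have "depth (K' (Suc j)) (letters L v j) L \<le> depth (letters L v (Suc j)) (letters L v j) L"
    using assms by (intro depth_mono kbr_subset letters_disjoint) auto
  then show ?thesis using hw_v assms by simp
qed

lemma s_ops_to_u:
  "op_prod (map s_op [2..<i + 1]) (op_prod (map s_op [1..<i]) (Some (word_of L f))) = Some (word_of L u)"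
proof -
  have 1: "op_prod (map s_op [1..<i]) (Some (word_of L f)) = Some (word_of L v)"
    unfolding v_def by (rule s_op_chain(1)[OF i sat_f])
  have 2: "op_prod (map s_op [2..<Suc i]) (Some (word_of L v)) = Some (word_of L u)"
    unfolding u_def using i by (intro s_op_chain(1) sat_v) simp_all
  show ?thesis by (simp only: 1 2 Suc_eq_plus1[symmetric])
qed

end

section \<open>Lowering the leftmost bracketed letters\<close>

locale lowering = highest +
  assumes nonzero: "e_neg1 (Some (word_of L u)) \<noteq> None"
begin

definition "q j = Min (K' j)"

definition "Q = q ` {2..Suc i}"

definition "v' x = (if x \<in> Q then v x - 1 else v x)"

definition "p j = first_descent L (Suc i) f (Suc i - j)"

definition "P = p ` {1..Suc i}"

text \<open>At \<open>p 1\<close> this produces the letter 0, a placeholder that belongs to no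
  level; the first word of the algorithm has a 1 there.\<close>

definition "c0 x = (if x \<in> P then f x - 1 else f x)"

lemma letters_u: "letters L u 2 = K' 2"
  using letters_raised(2)[of 1 "Suc i" L v] i by (simp add: u_def numeral_2_eq_2)

text \<open>A nonzero \<open>e_neg1\<close> supplies a 2 in \<open>u\<close>, hence a bracketed 2 in
  \<open>v\<close>, and a bracketed letter requires a bracketed letter one higher.\<close>

lemma K'_nonempty: "2 \<le> j \<Longrightarrow> j \<le> Suc i \<Longrightarrow> K' j \<noteq> {}"
proof (induction j rule: dec_induct)
  case base
  then show ?case using e_neg1_word_of(1)[OF nonzero] letters_u by simp
next
  case (step n)
  then have *: "matched (K' (Suc n)) (letters L v n) \<noteq> {}" by (simp add: kbr_step[of n])
  show ?case
  proof
    assume "K' (Suc n) = {}"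
    then have "depth (K' (Suc n)) (letters L v n) x = 0" for x by (intro depth_eq_0) simp
    then show False using * by (simp add: matched_def)
  qed
qed

lemma q_Min:
  assumes "2 \<le> j" "j \<le> Suc i"
  shows "q j \<in> K' j" "\<And>x. x \<in> K' j \<Longrightarrow> q j \<le> x" "q j < L" "v (q j) = j"
proof -
  have "K' j \<subseteq> {..<L}" using kbrD[of _ L "Suc i" v j] assms by auto
  then have fin: "finite (K' j)" by (rule finite_subset) simp
  show *: "q j \<in> K' j" unfolding q_def using fin K'_nonempty[OF assms] by (rule Min_in)
  show "q j \<le> x" if "x \<in> K' j" for x unfolding q_def using fin that by (rule Min_le)
  show "q j < L" "v (q j) = j" using kbrD[OF *] assms by auto
qed

text \<open>By \<open>matched_least\<close> the leftmost bracketed letters follow each other like an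
  initial sequence of \<open>v\<close>.\<close>

lemma q_next:
  assumes "2 \<le> j" "j \<le> i"
  shows "q (Suc j) < q j" "q j \<in> letters L v j" "\<And>x. x \<in> letters L v j \<Longrightarrow> q (Suc j) < x \<Longrightarrow> q j \<le> x"
proof -
  have "q j \<in> matched (K' (Suc j)) (letters L v j)"
    "\<And>x. x \<in> matched (K' (Suc j)) (letters L v j) \<Longrightarrow> q j \<le> x"
    using q_Min[of j] assms kbr_step[of j "Suc i" L v] by simp_all
  note * = matched_least[OF q_Min(1,2)[of "Suc j"] this]
  show "q (Suc j) < q j" "q j \<in> letters L v j" "\<And>x. x \<in> letters L v j \<Longrightarrow> q (Suc j) < x \<Longrightarrow> q j \<le> x"
    using * assms by simp_all
qed

lemma Q_iff: "x \<in> Q \<longleftrightarrow> 2 \<le> v x \<and> v x \<le> Suc i \<and> x = q (v x)"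
  using q_Min(4) by (auto simp: Q_def)

lemma letters_v':
  assumes "2 \<le> j" "j \<le> i"
  shows "letters L v' j = insert (q (Suc j)) (letters L v j - {q j})"
proof (intro set_eqI)
  fix x
  have "v (q (Suc j)) = Suc j" "q (Suc j) < L" "v (q j) = j"
    using q_Min[of "Suc j"] q_Min[of j] assms by auto
  then show "x \<in> letters L v' j \<longleftrightarrow> x \<in> insert (q (Suc j)) (letters L v j - {q j})"
    using assms by (cases "v x = Suc j") (auto simp: letters_def v'_def Q_iff)
qed

lemma letters_v'_top: "letters L v' (Suc i) = letters L v (Suc i) - {q (Suc i)}"
  using q_Min(4)[of "Suc i"] i by (auto simp: letters_def v'_def Q_iff)

text \<open>Downward induction: at level \<open>n\<close> the leftmost opening
  \<open>q (Suc n)\<close> becomes a closing letter and \<open>q n\<close> leaves, which is the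
  situation of \<open>matched_remove_least\<close>.\<close>

lemma kbr_v': "2 \<le> j \<Longrightarrow> j \<le> Suc i \<Longrightarrow> kbr L (Suc i) v' j = K' j - {q j}"
proof (rule inc_induct[of j "Suc i"])
  show "kbr L (Suc i) v' (Suc i) = K' (Suc i) - {q (Suc i)}"
    by (simp add: kbr_top letters_v'_top)
next
  fix n assume "2 \<le> j" "j \<le> n" "n < Suc i" and IH: "kbr L (Suc i) v' (Suc n) = K' (Suc n) - {q (Suc n)}"
  then have n: "2 \<le> n" "n \<le> i" by auto
  have "K' (Suc n) \<inter> letters L v n = {}"
    using kbr_subset[of "Suc n" "Suc i" L v] letters_disjoint[of "Suc n" n L v] n by auto
  note matched_remove_least[OF q_Min(1,2)[of "Suc n"] q_next(2,1,3)[OF n] this]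
  then show "kbr L (Suc i) v' n = K' n - {q n}"
    using n IH by (simp add: kbr_step[of n] letters_v')
qed

lemma sat_v':
  assumes "2 \<le> j" "j < Suc i"
  shows "depth (kbr L (Suc i) v' (Suc j)) (letters L v' j) L = 0"
proof -
  have j: "2 \<le> j" "j \<le> i" using assms by auto
  have "K' (Suc j) \<inter> letters L v j = {}"
    using kbr_subset[of "Suc j" "Suc i" L v] letters_disjoint[of "Suc j" j L v] j by auto
  note depth_remove_least[OF q_Min(1,2)[of "Suc j"] q_next(2,1,3)[OF j] this, of L]
  then show ?thesis using sat_v[OF assms] j by (simp add: kbr_v' letters_v')
qed

text \<open>In \<open>u\<close> each \<open>q j\<close> still carries \<open>j\<close>, being
  bracketed in \<open>v\<close>. In \<open>v'\<close> it carries \<open>j - 1\<close> and is no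
  longer bracketed, so for \<open>j > 2\<close> raising restores \<open>j\<close>. Only at
  \<open>q 2\<close>, whose letter 1 is below the raised range, does a difference remain.\<close>

lemma u_eq_raised: "word_of L (u(q 2 := 1)) = word_of L (raised L (Suc i) 2 v')"
proof (rule word_of_cong)
  fix x assume x: "x < L"
  have q2: "v (q 2) = 2" using q_Min(4)[of 2] i by simp
  show "(u(q 2 := 1)) x = raised L (Suc i) 2 v' x"
  proof (cases "x \<in> Q")
    case True
    then have vx: "2 \<le> v x" "v x \<le> Suc i" "x = q (v x)" by (simp_all add: Q_iff)
    have v'x: "v' x = v x - 1" using True by (simp add: v'_def)
    have "x \<in> K' (v x)" using q_Min(1)[OF vx(1,2)] vx(3) by simp
    then have ux: "u x = v x" by (simp add: u_def raised_def)
    show ?thesis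
    proof (cases "v x = 2")
      case True
      then show ?thesis using vx(3) v'x by (simp add: raised_def)
    next
      case False
      have "x \<notin> K' (v x - 1)"
      proof
        assume "x \<in> K' (v x - 1)"
        from kbrD[OF this] vx(1,2) have "v x = v x - 1" by simp
        then show False using vx(1) by linarith
      qed
      then have "x \<notin> kbr L (Suc i) v' (v' x)" using kbr_v'[of "v x - 1"] vx False v'x by simp
      moreover have "x \<noteq> q 2" using q2 False by auto
      ultimately show ?thesis using vx False v'x ux by (auto simp: raised_def)
    qed
  next
    case False
    then have "v' x = v x" by (simp add: v'_def)
    moreover have "x \<noteq> q 2" using False i by (auto simp: Q_def)
    moreover have "x \<in> kbr L (Suc i) v' (v x) \<longleftrightarrow> x \<in> K' (v x)" if "2 \<le> v x" "v x \<le> Suc i"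
      using False that kbr_v'[OF that] by (auto simp: Q_iff)
    ultimately show ?thesis by (auto simp: u_def raised_def)
  qed
qed

lemma s_ops_to_v':
  "op_prod (map s_op (rev [2..<i + 1])) (e_neg1 (Some (word_of L u))) = Some (word_of L v')"
proof -
  have "e_neg1 (Some (word_of L u)) = Some (word_of L (raised L (Suc i) 2 v'))"
    by (rule e_neg1_word_of(2)[OF nonzero, unfolded letters_u q_def[symmetric] u_eq_raised])
  moreover have "op_prod (map s_op (rev [2..<Suc i])) (Some (word_of L (raised L (Suc i) 2 v'))) = Some (word_of L v')"
    using i by (intro s_op_chain(2) sat_v') simp_all
  ultimately show ?thesis by (simp only: Suc_eq_plus1[symmetric])
qed

section \<open>The initial sequence and its comparison with \<open>q\<close>\<close>

lemma p_top: "p (Suc i) \<in> letters L f (Suc i)" "\<And>x. x \<in> letters L f (Suc i) \<Longrightarrow> p (Suc i) \<le> x"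
proof -
  have "q (Suc i) \<in> letters L f (Suc i)"
    using q_Min(1)[of "Suc i"] i by (simp add: kbr_top letters_v_top)
  then show "p (Suc i) \<in> letters L f (Suc i)" "\<And>x. x \<in> letters L f (Suc i) \<Longrightarrow> p (Suc i) \<le> x"
    by (auto simp: p_def intro: LeastI Least_le)
qed

lemma q_top: "q (Suc i) = p (Suc i)"
  using q_Min(1,2)[of "Suc i"] p_top i by (simp add: kbr_top letters_v_top antisym)

lemma p_Least: "1 \<le> j \<Longrightarrow> j \<le> i \<Longrightarrow> p j = (LEAST x. p (Suc j) < x \<and> x \<in> letters L f j)"
  by (simp add: p_def Suc_diff_le)

lemma p_letters: "1 \<le> j \<Longrightarrow> j \<le> Suc i \<Longrightarrow> p j \<in> letters L f j"
  and p_next: "1 \<le> j \<Longrightarrow> j \<le> i \<Longrightarrow> p (Suc j) < p j"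
    "\<And>x. 1 \<le> j \<Longrightarrow> j \<le> i \<Longrightarrow> x \<in> letters L f j \<Longrightarrow> p (Suc j) < x \<Longrightarrow> p j \<le> x"
proof -
  \<comment> \<open>The final depth is 0, so the opening at \<open>p (Suc n)\<close> must be
    followed by some letter \<open>n\<close>.\<close>
  have descend: "p (Suc n) < p n \<and> p n \<in> letters L f n"
    if n: "1 \<le> n" "n \<le> i" "p (Suc n) \<in> letters L f (Suc n)" for n
  proof -
    have "p (Suc n) < L" using n by (simp add: letters_def)
    then obtain x where "x \<in> letters L f n" "p (Suc n) < x"
      using depth_next_close[OF n(3) _ hw[OF n(1,2)]] by blast
    then show ?thesis unfolding p_Least[OF n(1,2)]
      using LeastI[of "\<lambda>x. p (Suc n) < x \<and> x \<in> letters L f n" x] by simp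
  qed
  have *: "p j \<in> letters L f j" if "1 \<le> j" "j \<le> Suc i" for j
    using that(2,1)
  proof (induction j rule: inc_induct)
    case base
    then show ?case using p_top by simp
  next
    case (step n)
    then show ?case using descend[of n] by simp
  qed
  show "1 \<le> j \<Longrightarrow> j \<le> Suc i \<Longrightarrow> p j \<in> letters L f j" by (rule *)
  show "1 \<le> j \<Longrightarrow> j \<le> i \<Longrightarrow> p (Suc j) < p j" using descend * by simp
  show "p j \<le> x" if "1 \<le> j" "j \<le> i" "x \<in> letters L f j" "p (Suc j) < x" for x
    unfolding p_Least[OF that(1,2)] using that(3,4) by (simp add: Least_le)
qed

lemma p_value: "1 \<le> j \<Longrightarrow> j \<le> Suc i \<Longrightarrow> p j < L \<and> f (p j) = j"
  using p_letters by (auto simp: letters_def)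

text \<open>No letter \<open>n\<close> lies strictly between \<open>p (Suc n)\<close> and
  \<open>p n\<close>, so the bracketed \<open>Suc n\<close> there is still open at
  \<open>p n\<close>.\<close>

lemma p_bracketed: "1 \<le> j \<Longrightarrow> j \<le> i \<Longrightarrow> p j \<in> K j"
proof (rule inc_induct[of j i])
  show "p i \<in> K i" using p_letters[of i] i by (simp add: kbr_top)
next
  fix n assume "1 \<le> j" "j \<le> n" "n < i" "p (Suc n) \<in> K (Suc n)"
  moreover from this have "0 < depth (K (Suc n)) (letters L f n) (p n)"
    using p_next[of n] by (intro depth_pos) auto
  ultimately show "p n \<in> K n" using p_letters[of n] by (simp add: kbr_step[of n] matched_def)
qed

lemma P_iff: "x \<in> P \<longleftrightarrow> 1 \<le> f x \<and> f x \<le> Suc i \<and> x = p (f x)"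
  using p_value by (auto simp: P_def)

lemma v_bracketed: "x \<in> K j \<Longrightarrow> j \<le> i \<Longrightarrow> v x = j"
  using kbrD[of x L i f j] by (simp add: v_def raised_def)

text \<open>From \<open>f\<close> to \<open>c0\<close> the bracketed letters \<open>j\<close> trade
  \<open>p j\<close> for \<open>q (Suc j)\<close>, and the letters \<open>j - 1\<close> trade
  \<open>p (j - 1)\<close> for \<open>p j\<close>. Then \<open>depth_shift\<close> yields the same
  trade one level down, and its last conclusion reproduces \<open>gap\<close> there.\<close>

lemma shift_step:
  assumes j: "2 \<le> j" "j \<le> i" and le: "q (Suc j) \<le> p (Suc j)"
    and gap: "\<And>x. x \<in> K j \<Longrightarrow> q (Suc j) < x \<Longrightarrow> p j \<le> x"
  shows "q j \<le> p j"
    and "depth (insert (q (Suc j)) (K j - {p j})) (insert (p j) (letters L f (j - 1) - {p (j - 1)})) L = 0"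
    and "matched (insert (q (Suc j)) (K j - {p j})) (insert (p j) (letters L f (j - 1) - {p (j - 1)})) =
      insert (q j) (K (j - 1) - {p (j - 1)})"
    and "\<And>x. x \<in> K (j - 1) \<Longrightarrow> q j < x \<Longrightarrow> p (j - 1) \<le> x"
proof -
  have Kj: "K (j - 1) = matched (K j) (letters L f (j - 1))"
    using j kbr_step[of "j - 1" i L f] by simp
  have disj: "K j \<inter> letters L f (j - 1) = {}"
    proof -
    have "j \<noteq> j - 1" using j by simp
    then show ?thesis using kbr_subset[OF j(2), of L f] letters_disjoint[of j "j - 1" L f] by blast
  qed
  have vq: "v (q (Suc j)) = Suc j" using q_Min(4) j by simp
  have lt: "q (Suc j) < p j" using le p_next(1)[of j] j by simp
  have notK: "q (Suc j) \<notin> K j" using v_bracketed[of "q (Suc j)" j] vq j by auto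
  \<comment> \<open>Raising adds at most 1, so a letter \<open>Suc j\<close> of \<open>v\<close> is
    at least \<open>j\<close> in \<open>f\<close>.\<close>
  have notB: "q (Suc j) \<notin> letters L f (j - 1)"
    using vq j by (auto simp: letters_def v_def raised_def split: if_splits)
  have m: "p (j - 1) \<in> letters L f (j - 1)" "p j < p (j - 1)"
    "\<And>x. x \<in> letters L f (j - 1) \<Longrightarrow> p j < x \<Longrightarrow> p (j - 1) \<le> x"
    using p_letters[of "j - 1"] p_next[of "j - 1"] j by simp_all
  \<comment> \<open>By \<open>letters_v\<close> the set in which \<open>q j\<close> has to be the
    next element is exactly the set of letters \<open>j\<close> of \<open>v\<close>.\<close>
  have m0: "q j \<in> K j \<union> (letters L f (j - 1) - matched (K j) (letters L f (j - 1)))" "q (Suc j) < q j"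
    "\<And>x. x \<in> K j \<union> (letters L f (j - 1) - matched (K j) (letters L f (j - 1))) \<Longrightarrow> q (Suc j) < x \<Longrightarrow> q j \<le> x"
    using q_next[OF j] letters_v[OF j] Kj by simp_all
  note shift = depth_shift[OF disj p_bracketed lt notK notB gap m m0]
  show "q j \<le> p j" using shift(1) j by simp
  have "p (j - 1) < L" "q j < L" using m q_Min(3) j by (simp_all add: letters_def)
  then show "depth (insert (q (Suc j)) (K j - {p j})) (insert (p j) (letters L f (j - 1) - {p (j - 1)})) L = 0"
    using shift(2)[of L] sat_f[of "j - 1"] j by simp
  show "matched (insert (q (Suc j)) (K j - {p j})) (insert (p j) (letters L f (j - 1) - {p (j - 1)})) =
      insert (q j) (K (j - 1) - {p (j - 1)})"
    using shift(3) j Kj by simp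
  show "p (j - 1) \<le> x" if "x \<in> K (j - 1)" "q j < x" for x
    using shift(4)[of x] j Kj that by simp
qed

lemma q_le_p:
  assumes "1 \<le> j" "j \<le> i"
  shows "q (Suc j) \<le> p (Suc j)" and "\<And>x. x \<in> K j \<Longrightarrow> q (Suc j) < x \<Longrightarrow> p j \<le> x"
proof -
  have "q (Suc j) \<le> p (Suc j) \<and> (\<forall>x\<in>K j. q (Suc j) < x \<longrightarrow> p j \<le> x)"
    using assms(2,1)
  proof (induction j rule: inc_induct)
    case base
    then show ?case using q_top p_next(2)[of i] i by (simp add: kbr_top)
  next
    case (step n)
    then show ?case using shift_step(1,4)[of "Suc n"] by simp
  qed
  then show "q (Suc j) \<le> p (Suc j)" "\<And>x. x \<in> K j \<Longrightarrow> q (Suc j) < x \<Longrightarrow> p j \<le> x" by auto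
qed

lemma letters_c0:
  assumes "1 \<le> j" "j \<le> i"
  shows "letters L c0 j = insert (p (Suc j)) (letters L f j - {p j})"
proof (intro set_eqI)
  fix x
  have "f (p (Suc j)) = Suc j" "p (Suc j) < L" "f (p j) = j"
    using p_value[of "Suc j"] p_value[of j] assms by auto
  then show "x \<in> letters L c0 j \<longleftrightarrow> x \<in> insert (p (Suc j)) (letters L f j - {p j})"
    using assms by (cases "f x = Suc j") (auto simp: letters_def c0_def P_iff)
qed

lemma kbr_c0: "1 \<le> j \<Longrightarrow> j \<le> i \<Longrightarrow> kbr L i c0 j = insert (q (Suc j)) (K j - {p j})"
proof (rule inc_induct[of j i])
  show "kbr L i c0 i = insert (q (Suc i)) (K i - {p i})"
    using letters_c0[of i] i by (simp add: kbr_top q_top)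
next
  fix n assume "1 \<le> j" "j \<le> n" "n < i"
    and IH: "kbr L i c0 (Suc n) = insert (q (Suc (Suc n))) (K (Suc n) - {p (Suc n)})"
  then show "kbr L i c0 n = insert (q (Suc n)) (K n - {p n})"
    using shift_step(3)[of "Suc n"] q_le_p[of "Suc n"] by (simp add: kbr_step[of n] letters_c0)
qed

lemma sat_c0:
  assumes "1 \<le> j" "j < i"
  shows "depth (kbr L i c0 (Suc j)) (letters L c0 j) L = 0"
  using shift_step(2)[of "Suc j"] q_le_p[of "Suc j"] assms by (simp add: kbr_c0 letters_c0)

text \<open>For \<open>j > 1\<close> the letter \<open>j - 1\<close> of \<open>c0\<close> at
  \<open>p j\<close> is bracketed only if \<open>p j = q j\<close>, where \<open>v'\<close> has
  \<open>j - 1\<close> too; otherwise it is raised back to \<open>j\<close>. Outside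
  \<open>P\<close> the words \<open>c0\<close> and \<open>f\<close> agree, and among letters below
  \<open>i\<close> their bracketing differs only at the positions of \<open>q\<close>, which are
  those that \<open>v'\<close> lowers.\<close>

lemma v'_eq_raised: "word_of L v' = word_of L ((raised L i 1 c0)(p 1 := 1))"
proof (rule word_of_cong)
  fix x assume x: "x < L"
  have p1: "v (p 1) = 1" "p 1 \<notin> Q" using v_bracketed[OF p_bracketed[of 1]] i by (auto simp: Q_iff)
  show "v' x = ((raised L i 1 c0)(p 1 := 1)) x"
  proof (cases "x = p 1")
    case True
    then show ?thesis using p1 by (simp add: v'_def)
  next
    case x1: False
    show ?thesis
    proof (cases "x \<in> P")
      case True
      define j where "j = f x"
      have j1: "1 \<le> j" "j \<le> Suc i" "x = p j" using True unfolding P_iff j_def by blast+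
      moreover have "j \<noteq> 1" using j1(3) x1 by blast
      ultimately have j: "2 \<le> j" "j \<le> Suc i" "x = p j" by simp_all
      have c0x: "c0 x = j - 1" using True by (simp add: c0_def j_def)
      have notK: "x \<notin> K (j - 1)"
      proof
        assume "x \<in> K (j - 1)"
        from kbrD[OF this] j(2) have "j = j - 1" by (simp add: j_def)
        then show False using j(1) by linarith
      qed
      have K: "x \<in> kbr L i c0 (j - 1) \<longleftrightarrow> x = q j" using kbr_c0[of "j - 1"] j notK by auto
      show ?thesis
      proof (cases "x = q j")
        case True
        then have "x \<in> Q" "v x = j" using q_Min(4)[of j] j by (auto simp: Q_def)
        then show ?thesis using True x1 K c0x by (simp add: v'_def raised_def)
      next
        case False
        then have "j \<noteq> Suc i" using q_top j(3) by auto
        then have ji: "j \<le> i" using j by simp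
        then have "v x = j" using v_bracketed[OF p_bracketed[of j]] j by simp
        moreover from this have "x \<notin> Q" using False by (simp add: Q_iff)
        moreover have "1 \<le> j - 1" "j - 1 < i" "Suc (j - 1) = j" using j ji by auto
        ultimately show ?thesis using x1 K c0x False by (simp add: v'_def raised_def)
      qed
    next
      case nP: False
      define y where "y = f x"
      have c0x: "c0 x = y" using nP by (simp add: c0_def y_def)
      show ?thesis
      proof (cases "1 \<le> y \<and> y < i")
        case False
        then have vx: "v x = y" by (auto simp: v_def raised_def y_def)
        have "x \<notin> Q"
        proof
          assume "x \<in> Q"
          then have y: "2 \<le> y" "y \<le> Suc i" "x = q y" using vx by (auto simp: Q_iff)
          then consider "y = Suc i" | "y = i" using False by force
          then show False
          proof cases
            case 1
            then show ?thesis using y q_top nP i by (simp add: P_def)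
          next
            case 2
            then have "x \<in> K i" using x by (simp add: kbr_top letters_def y_def)
            then have "p i \<le> x" using q_le_p(2)[of i x] q_next(1)[of i] 2 y i by simp
            moreover have "x \<le> p i" using q_le_p(1)[of "i - 1"] 2 y by simp
            ultimately show ?thesis using nP i by (auto simp: P_def)
          qed
        qed
        then show ?thesis using vx c0x x1 False by (auto simp: v'_def raised_def)
      next
        case y: True
        have xp: "x \<noteq> p y" using nP y by (auto simp: P_def)
        have K: "x \<in> kbr L i c0 y \<longleftrightarrow> x \<in> K y \<or> x = q (Suc y)" using kbr_c0[of y] y xp by auto
        have vx: "v x = (if x \<in> K y then y else Suc y)" using y by (simp add: v_def raised_def y_def)
        show ?thesis
        proof (cases "x = q (Suc y)")
          case True
          then have "v x = Suc y" "x \<in> Q" using q_Min(4)[of "Suc y"] y by (auto simp: Q_def)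
          then show ?thesis using True K c0x x1 by (simp add: v'_def raised_def)
        next
          case nq: False
          have "x \<notin> Q"
          proof
            assume "x \<in> Q"
            then have "x \<in> K y" "2 \<le> y" "x = q y" using vx nq by (auto simp: Q_iff split: if_splits)
            moreover from this have "p y \<le> x" using q_le_p(2)[of y x] q_next(1)[of y] y by simp
            moreover have "q y \<le> p y" using q_le_p(1)[of "y - 1"] y \<open>2 \<le> y\<close> by simp
            ultimately show False using xp by simp
          qed
          then show ?thesis using nq K c0x x1 vx y by (simp add: v'_def raised_def)
        qed
      qed
    qed
  qed
qed

end

section \<open>The scanning algorithm\<close>

text \<open>The positions carry different letters and so are distinct; each update therefore meets
  the original letter.\<close>

lemma lower_fold:
  assumes "distinct js" "\<And>j. j \<in> set js \<Longrightarrow> g (p j) = j"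
  shows "fold (\<lambda>j w. w[p j := j - 1]) js (word_of L g) =
    word_of L (\<lambda>x. if x \<in> p ` set js then g x - 1 else g x)"
  using assms
proof (induction js arbitrary: g)
  case (Cons j js)
  have gj: "g (p j) = j" using Cons.prems(2) by simp
  have ne: "p j' \<noteq> p j" if "j' \<in> set js" for j'
  proof
    assume eq: "p j' = p j"
    have "g (p j') = j'" using Cons.prems(2)[of j'] that by simp
    then have "j' = j" unfolding eq gj by (rule sym)
    then show False using Cons.prems(1) that by simp
  qed
  let ?g = "g(p j := j - 1)"
  have "?g (p j') = j'" if "j' \<in> set js" for j'
    using Cons.prems(2)[of j'] ne[OF that] that by simp
  then have "fold (\<lambda>j w. w[p j := j - 1]) js (word_of L ?g) =
    word_of L (\<lambda>x. if x \<in> p ` set js then ?g x - 1 else ?g x)"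
    using Cons.prems(1) by (intro Cons.IH) simp_all
  also have "\<dots> = word_of L (\<lambda>x. if x \<in> p ` set (j # js) then g x - 1 else g x)"
  proof (rule word_of_cong)
    fix x
    have "p j \<notin> p ` set js" using ne by (metis image_iff)
    then show "(if x \<in> p ` set js then ?g x - 1 else ?g x) = (if x \<in> p ` set (j # js) then g x - 1 else g x)"
      using gj by (cases "x = p j") simp_all
  qed
  finally show ?case by (simp add: word_of_update)
qed simp

context lowering
begin

lemma lower_along_eq: "lower_along i p (word_of L f) = word_of L (c0(p 1 := 1))"
proof -
  have p: "f (p j) = j" if "j \<in> set (rev [2..<i + 2])" for j
    using p_value[of j] that by auto
  have "lower_along i p (word_of L f) =
    word_of L (\<lambda>x. if x \<in> p ` set (rev [2..<i + 2]) then f x - 1 else f x)"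
    unfolding lower_along_def by (rule lower_fold[where g = f and p = p, OF _ p]) simp_all
  also have "\<dots> = word_of L (c0(p 1 := 1))"
  proof (rule word_of_cong)
    fix x
    have f1: "f (p 1) = 1" using p_value[of 1] i by simp
    have set: "set (rev [2..<i + 2]) = {2..Suc i}" by auto
    have "p 1 \<notin> p ` {2..Suc i}" using f1 p unfolding set by fastforce
    moreover have "P = insert (p 1) (p ` {2..Suc i})"
    proof -
      have "{1..Suc i} = insert 1 {2..Suc i}" using i by auto
      then show ?thesis by (simp add: P_def)
    qed
    ultimately show "(if x \<in> p ` set (rev [2..<i + 2]) then f x - 1 else f x) = (c0(p 1 := 1)) x"
      using f1 unfolding set c0_def by auto
  qed
  finally show ?thesis .
qed

lemma initial_sequence_p: "initial_sequence (i + 1) (word_of L f) p"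
  unfolding initial_sequence_def
proof (intro conjI ballI)
  show "is_leftmost (word_of L f) (\<lambda>q. word_of L f ! q = i + 1) (p (i + 1))"
  proof -
    have "word_of L f ! r \<noteq> i + 1" if "r < p (i + 1)" for r
    proof
      assume r: "word_of L f ! r = i + 1"
      have "r < L" using that p_value[of "i + 1"] i by simp
      then have "r \<in> letters L f (Suc i)" using r by (simp add: letters_def)
      then have "p (i + 1) \<le> r" using p_top(2) by simp
      then show False using that by simp
    qed
    then show ?thesis using p_value[of "i + 1"] i unfolding is_leftmost_def by simp
  qed
next
  fix j assume "j \<in> {1..<i + 1}"
  then have j: "1 \<le> j" "j \<le> i" by auto
  have "\<not> (p (j + 1) < r \<and> word_of L f ! r = j)" if "r < p j" for r
  proof
    assume r: "p (j + 1) < r \<and> word_of L f ! r = j"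
    have "r < L" using that p_value[of j] j by simp
    then have "r \<in> letters L f j" using r by (simp add: letters_def)
    then have "p j \<le> r" using p_next(2)[OF j] r by simp
    then show False using that by simp
  qed
  then show "is_leftmost (word_of L f) (\<lambda>q. p (j + 1) < q \<and> word_of L f ! q = j) (p j)"
    using p_next(1)[OF j] p_value[of j] j unfolding is_leftmost_def by auto
qed

text \<open>A state holds a word with the letter \<open>n\<close> at \<open>t\<close>, where
  \<open>n + 1\<close> is still to be written. The conditions are guarded by \<open>n < i\<close> so
  that states exist for all \<open>n\<close> and dependent choice yields one infinite
  sequence.\<close>

definition reached :: "nat \<Rightarrow> (nat \<Rightarrow> nat) \<times> nat \<Rightarrow> bool" where
  "reached n = (\<lambda>(c, t). (n = 0 \<longrightarrow> c = c0 \<and> t = p 1) \<and> (n < i \<longrightarrow> t < L \<and> c t = n \<and>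
     (\<forall>j. Suc n \<le> j \<longrightarrow> j < i \<longrightarrow> depth (kbr L i c (Suc j)) (letters L c j) L = 0) \<and>
     op_prod (map s_op (rev [1..<Suc n])) (Some (word_of L v')) =
       Some (word_of L ((raised L i (Suc n) c)(t := Suc n)))))"

definition scanned :: "nat \<Rightarrow> (nat \<Rightarrow> nat) \<times> nat \<Rightarrow> (nat \<Rightarrow> nat) \<times> nat \<Rightarrow> bool" where
  "scanned n = (\<lambda>(c, t) (c', t'). Suc n < i \<longrightarrow> c' = c(t := Suc n) \<and>
     cyclic_scan_left (word_of L c') t
       (\<lambda>q. word_of L c' ! q = Suc n \<and> q \<notin> k_bracketed i (word_of L c')) t')"

lemma reached_0: "reached 0 (c0, p 1)"
proof -
  have p1: "p 1 < L" "f (p 1) = 1" using p_value[of 1] i by auto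
  moreover have "p 1 \<in> P" using i by (auto simp: P_def)
  ultimately have "c0 (p 1) = 0" by (simp add: c0_def)
  then show ?thesis using p1 sat_c0 v'_eq_raised by (simp add: reached_def op_prod_simps)
qed

lemma reached_Suc:
  assumes "reached n (c, t)"
  shows "\<exists>ct'. reached (Suc n) ct' \<and> scanned n (c, t) ct'"
proof (cases "Suc n < i")
  case False
  then show ?thesis by (intro exI[of _ "(c, t)"]) (simp add: reached_def scanned_def)
next
  case True
  then have r: "t < L" "c t < Suc n"
    "\<And>j. Suc n \<le> j \<Longrightarrow> j < i \<Longrightarrow> depth (kbr L i c (Suc j)) (letters L c j) L = 0"
    "op_prod (map s_op (rev [1..<Suc n])) (Some (word_of L v')) =
       Some (word_of L ((raised L i (Suc n) c)(t := Suc n)))"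
    using assms by (auto simp: reached_def)
  obtain t' where t': "t' < L" "(c(t := Suc n)) t' = Suc n"
    "cyclic_scan_left (word_of L (c(t := Suc n))) t
       (\<lambda>q. word_of L (c(t := Suc n)) ! q = Suc n \<and> q \<notin> k_bracketed i (word_of L (c(t := Suc n)))) t'"
    "s_op (Suc n) (Some (word_of L ((raised L i (Suc n) c)(t := Suc n)))) =
       Some (word_of L ((raised L i (Suc (Suc n)) (c(t := Suc n)))(t' := Suc (Suc n))))"
    "\<And>j. Suc (Suc n) \<le> j \<Longrightarrow> j < i \<Longrightarrow>
       depth (kbr L i (c(t := Suc n)) (Suc j)) (letters L (c(t := Suc n)) j) L = 0"
    using scan_step[OF _ True r(1-3) refl] by auto
  have "rev [1..<Suc (Suc n)] = Suc n # rev [1..<Suc n]" by simp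
  then have "op_prod (map s_op (rev [1..<Suc (Suc n)])) (Some (word_of L v')) =
       Some (word_of L ((raised L i (Suc (Suc n)) (c(t := Suc n)))(t' := Suc (Suc n))))"
    using r(4) t'(4) by (simp only: list.map op_prod_simps)
  then have "reached (Suc n) (c(t := Suc n), t')"
    unfolding reached_def using t'(1,2,5) by (simp del: upt_Suc fun_upd_apply)
  moreover have "scanned n (c, t) (c(t := Suc n), t')"
    unfolding scanned_def using t'(3) by simp
  ultimately show ?thesis by blast
qed

lemma algorithm:
  obtains t c where "c 1 = lower_along i p (word_of L f)" "t 0 = p 1"
    "\<And>m. m \<in> {1..i - 1} \<Longrightarrow> cyclic_scan_left (c m) (t (m - 1))
      (\<lambda>q. c m ! q = m \<and> q \<notin> k_bracketed i (c m)) (t m) \<and> c (m + 1) = (c m)[t m := m + 1]"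
    "op_prod (map s_op (rev [1..<i])) (Some (word_of L v')) = Some (c i)"
proof -
  have "\<exists>F. \<forall>n. reached n (F n) \<and> scanned n (F n) (F (Suc n))"
    by (rule dependent_nat_choice) (use reached_0 reached_Suc in auto)
  then obtain F where F: "\<And>n. reached n (F n)" "\<And>n. scanned n (F n) (F (Suc n))" by blast
  define t where "t m = snd (F m)" for m
  \<comment> \<open>The word called \<open>c m\<close> in the theorem is the state of index
    \<open>m - 1\<close> with its pending letter \<open>m\<close> written.\<close>
  define c where "c m = word_of L ((fst (F (m - 1)))(t (m - 1) := m))" for m
  have "F 0 = (c0, p 1)" using F(1)[of 0] by (auto simp: reached_def split: prod.splits)
  then have t0: "t 0 = p 1" and "c 1 = word_of L (c0(p 1 := 1))" by (simp_all add: t_def c_def)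
  then have c1: "c 1 = lower_along i p (word_of L f)" by (simp add: lower_along_eq)
  show thesis
  proof (rule that[of c t, OF c1 t0])
    fix m assume "m \<in> {1..i - 1}"
    then obtain n where n: "m = Suc n" "Suc n < i" by (cases m) auto
    have s: "fst (F m) = (fst (F n))(t n := Suc n) \<and> cyclic_scan_left (word_of L (fst (F m))) (t n)
       (\<lambda>q. word_of L (fst (F m)) ! q = Suc n \<and> q \<notin> k_bracketed i (word_of L (fst (F m)))) (t m)"
      using F(2)[of n] n by (auto simp: scanned_def t_def split: prod.splits)
    then have cm: "c m = word_of L (fst (F m))" by (simp add: c_def n(1))
    have "cyclic_scan_left (c m) (t n) (\<lambda>q. c m ! q = Suc n \<and> q \<notin> k_bracketed i (c m)) (t m)"
      unfolding cm using s by (rule conjunct2)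
    moreover have "c (m + 1) = (c m)[t m := m + 1]"
      unfolding cm by (simp add: c_def word_of_update)
    ultimately show "cyclic_scan_left (c m) (t (m - 1))
      (\<lambda>q. c m ! q = m \<and> q \<notin> k_bracketed i (c m)) (t m) \<and> c (m + 1) = (c m)[t m := m + 1]"
      using n(1) by simp
  next
    \<comment> \<open>After the last reflection the range of raised letters is empty, so the state
      with its pending letter written is the whole word.\<close>
    obtain n where n: "Suc n = i" using i by (cases i) auto
    then have "n < i" "i - 1 = n" by auto
    obtain g s where gs: "F n = (g, s)" by (cases "F n")
    have "op_prod (map s_op (rev [1..<Suc n])) (Some (word_of L v')) =
      Some (word_of L ((raised L i (Suc n) g)(s := Suc n)))"
      using F(1)[of n] gs \<open>n < i\<close> by (simp add: reached_def del: upt_Suc)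
    moreover have "c i = word_of L (g(s := i))" unfolding c_def t_def \<open>i - 1 = n\<close> gs by simp
    ultimately show "op_prod (map s_op (rev [1..<i])) (Some (word_of L v')) = Some (c i)"
      unfolding n raised_self by simp
  qed
qed

end

text \<open>For \<open>i = 1\<close> all four lists of reflections are empty, so the separate clause
  of the definition fits the same formula.\<close>

lemma e_neg_expand:
  assumes "1 \<le> i"
  shows "e_neg i x = op_prod (map s_op (rev [1..<i])) (op_prod (map s_op (rev [2..<i + 1]))
    (e_neg1 (op_prod (map s_op [2..<i + 1]) (op_prod (map s_op [1..<i]) x))))"
proof (cases "i = 1")
  case True
  then show ?thesis by (simp add: e_neg_def op_prod_simps)
next
  case False
  then show ?thesis by (simp add: e_neg_def op_prod_simps del: upt_Suc)
qed

text \<open>If the operator killed \<open>b\<close>, the set of exponents would be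
  \<open>{0}\<close>, with maximum 0.\<close>

lemma e_neg_nonzero:
  assumes "1 \<le> i" "eps_neg i b = 1"
  shows "e_neg i (Some b) \<noteq> None"
proof -
  let ?S = "{k. (e_neg i ^^ k) (Some b) \<noteq> None}"
  have None: "e_neg i None = None"
  proof -
    have s: "op_prod (map s_op js) None = None" for js
      by (induction js) (simp_all add: op_prod_simps s_op_def)
    show ?thesis using assms(1) by (simp add: e_neg_expand s e_neg1_def del: upt_Suc)
  qed
  show ?thesis
  proof
    assume "e_neg i (Some b) = None"
    then have "(e_neg i ^^ Suc k) (Some b) = None" for k
      using None by (induction k) auto
    then have "?S \<subseteq> {0}" by (auto simp del: funpow.simps elim: nat.exhaust) (metis not0_implies_Suc option.distinct(1))
    then have "?S = {0}" by auto
    then show False using assms(2) by (simp add: eps_neg_def)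
  qed
qed

theorem theorem2p16:
  fixes n l i :: nat and b :: word
  assumes "n \<ge> 1" and "l \<ge> 1" and "i \<in> {1..n}"
    and "b \<in> words n l"
    and "highest_weight {1..i} b"
    and "eps_neg i b = 1"
  shows "\<exists>p t c.
           initial_sequence (i + 1) b p \<and>
           c 1 = lower_along i p b \<and>
           t 0 = p 1 \<and>
           (\<forall>m\<in>{1..i-1}.
              cyclic_scan_left (c m) (t (m - 1))
                (\<lambda>q. c m ! q = m \<and> q \<notin> k_bracketed i (c m)) (t m) \<and>
              c (m + 1) = (c m)[t m := m + 1]) \<and>
           e_neg i (Some b) = Some (c i)"
proof -
  define L f where "L = length b" and "f = (\<lambda>x. b ! x)"
  have b: "b = word_of L f"
    by (rule nth_equalityI) (simp_all add: L_def f_def)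
  have i: "1 \<le> i" using assms(3) by simp
  interpret highest L i f
  proof
    fix j assume j: "1 \<le> j" "j \<le> i"
    then have "e_op j (Some b) = None" using assms(5) by (simp add: highest_weight_def)
    from highest_weight_depth[OF this]
    show "depth (letters L f (Suc j)) (letters L f j) L = 0"
      by (simp add: letters_def L_def f_def)
  qed (rule i)
  have e: "e_neg i (Some b) = op_prod (map s_op (rev [1..<i])) (op_prod (map s_op (rev [2..<i + 1]))
      (e_neg1 (Some (word_of L u))))"
    unfolding e_neg_expand[OF i] unfolding b s_ops_to_u ..
  interpret lowering L i f
  proof
    show "e_neg1 (Some (word_of L u)) \<noteq> None"
    \<comment> \<open>The remaining reflections fix \<open>None\<close>, so a vanishing
      \<open>e_neg1\<close> would make the whole product vanish.\<close>
    proof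
      assume none: "e_neg1 (Some (word_of L u)) = None"
      have "op_prod (map s_op js) None = None" for js
        by (induction js) (simp_all add: op_prod_simps s_op_def)
      then show False using e_neg_nonzero[OF i assms(6)] e none by (simp del: upt_Suc)
    qed
  qed
  obtain t c where tc: "c 1 = lower_along i p (word_of L f)" "t 0 = p 1"
    "\<And>m. m \<in> {1..i - 1} \<Longrightarrow> cyclic_scan_left (c m) (t (m - 1))
      (\<lambda>q. c m ! q = m \<and> q \<notin> k_bracketed i (c m)) (t m) \<and> c (m + 1) = (c m)[t m := m + 1]"
    "op_prod (map s_op (rev [1..<i])) (Some (word_of L v')) = Some (c i)"
    by (rule algorithm, rule that)
  have "e_neg i (Some b) = Some (c i)" using tc(4) unfolding e s_ops_to_v' .
  moreover have "initial_sequence (i + 1) b p" using initial_sequence_p unfolding b .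
  ultimately show ?thesis using tc(1-3) unfolding b
    by (intro exI[of _ p] exI[of _ t] exI[of _ c]) simp
qed

end
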